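(* Let $C=(F,G,H)$ be a cell with respect to $\ell_1,\dots,\ell_n$, let $q$ be a power of $p$, and let $\mathcal{X}_q=\{(a_1/q,\dots,a_n/q): a_i\in\mathbb{Z},\ 0\le a_i\le q\}\subseteq\mathscr{I}^n$. Suppose $\delta_C|_{\mathcal{X}_q}$ attains a "local maximum" at $\mathbf{u}\in\mathcal{X}_q$, in the sense that the values of $\delta_C$ at all points of $\mathcal{X}_q$ adjacent to $\mathbf{u}$ are smaller than $\delta_C(\mathbf{u})$. Then $$\delta_C(\mathbf{t})=\delta_C(\mathbf{u})-d(\mathbf{t},\mathbf{u})$$ for all $\mathbf{t}\in\mathscr{I}^n$ with $d(\mathbf{t},\mathbf{u})\le\delta_C(\mathbf{u})$. In particular, $\delta_C$ is piecewise linear on that region, and has a local maximum at $\mathbf{u}$ in the usual sense.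
   Context: Let $\Bbbk$ be a field of characteristic $p>0$, $n\ge 1$, and let $\ell_1,\dots,\ell_n\in\Bbbk[x,y]$ be pairwise relatively prime (nonzero) linear forms; put $\ell=\prod_i\ell_i$ and $\ell^{\mathbf{a}}=\prod_i\ell_i^{a_i}$ for $\mathbf{a}\in\mathbb{Z}_{\ge0}^n$. The letter $q$ denotes a power of $p$ (including $q=1$), $[q]=\{0,1,\dots,q\}$, and $\mathscr{I}=[0,1]\cap\mathbb{Z}[1/p]$. For nonzero homogeneous $F,G,H\in\Bbbk[x,y]$, a homogeneous syzygy $(\alpha,\beta,\gamma)$ (with $\alpha F+\beta G+\gamma H=0$) has degree equal to the common degree of the nonzero terms among $\alpha F,\beta G,\gamma H$; $m(F,G,H)$ is the least degree of a nontrivial homogeneous syzygy, and $\delta(F,G,H)=\deg F+\deg G+\deg H-2m(F,G,H)$. A cell (with respect to $\ell_1,\dots,\ell_n$) is a triple $C=(F,G,H)$ of nonzero homogeneous polynomials in $\Bbbk[x,y]$ such that $F$, $G$ and $H\ell$ have no common factor. The function $\delta_C:\mathscr{I}^n\to\mathbb{Q}$ is defined by $\delta_C(\mathbf{a}/q)=\frac1q\,\delta(F^q,G^q,H^q\ell^{\mathbf{a}})$ for all $q$ and $\mathbf{a}\in[q]^n$ (this is well defined because $\delta(F^p,G^p,H^p)=p\,\delta(F,G,H)$). The taxi-cab distance is $d(\mathbf{t},\mathbf{u})=\sum_{i=1}^n|t_i-u_i|$. Two points of $\mathcal{X}_q$ are adjacent if they differ in exactly one coordinate, and there by exactly $1/q$.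 *)

theory Defs
  imports "HOL-Analysis.Analysis" "HOL-Computational_Algebra.Computational_Algebra"
begin

text \<open>
  The ring \<open>\<bbbk>[x,y]\<close> is rendered as \<open>\<bbbk>[x][y]\<close>, i.e. as the type \<open>'a poly poly\<close>:
  the coefficient of \<open>x\<^sup>i y\<^sup>j\<close> in \<open>P\<close> is \<open>coeff (coeff P j) i\<close>.
\<close>

type_synonym 'a bpoly = "'a poly poly"

definition monomials :: "'a::zero bpoly \<Rightarrow> (nat \<times> nat) set" where
  "monomials P = {(i, j). coeff (coeff P j) i \<noteq> 0}"

text \<open>The zero polynomial counts as homogeneous of every degree.\<close>

definition homogeneous_deg :: "nat \<Rightarrow> 'a::zero bpoly \<Rightarrow> bool" where
  "homogeneous_deg d P \<longleftrightarrow> (\<forall>(i, j) \<in> monomials P. i + j = d)"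

definition homogeneous :: "'a::zero bpoly \<Rightarrow> bool" where
  "homogeneous P \<longleftrightarrow> (\<exists>d. homogeneous_deg d P)"

text \<open>Only meaningful for \<open>P \<noteq> 0\<close>.\<close>

definition total_degree :: "'a::zero bpoly \<Rightarrow> nat" where
  "total_degree P = Max ((\<lambda>(i, j). i + j) ` monomials P)"

definition linear_form :: "'a::zero bpoly \<Rightarrow> bool" where
  "linear_form P \<longleftrightarrow> P \<noteq> 0 \<and> homogeneous_deg 1 P"

text \<open>
  The degree of a homogeneous syzygy is the common degree of the nonzero products
  among \<open>\<alpha> * F\<close>, \<open>\<beta> * G\<close>, \<open>\<gamma> * H\<close>, hence the degree conditions on the products.
\<close>

definition homogeneous_syzygy ::
  "nat \<Rightarrow> 'a::comm_ring_1 bpoly \<Rightarrow> 'a bpoly \<Rightarrow> 'a bpoly \<Rightarrow> 'a bpoly \<times> 'a bpoly \<times> 'a bpoly \<Rightarrow> bool"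
where
  "homogeneous_syzygy d F G H = (\<lambda>(\<alpha>, \<beta>, \<gamma>).
     \<alpha> * F + \<beta> * G + \<gamma> * H = 0 \<and>
     homogeneous \<alpha> \<and> homogeneous \<beta> \<and> homogeneous \<gamma> \<and>
     homogeneous_deg d (\<alpha> * F) \<and> homogeneous_deg d (\<beta> * G) \<and> homogeneous_deg d (\<gamma> * H))"

definition min_syzygy_degree :: "'a::comm_ring_1 bpoly \<Rightarrow> 'a bpoly \<Rightarrow> 'a bpoly \<Rightarrow> nat" where
  "min_syzygy_degree F G H = (LEAST d. \<exists>s. s \<noteq> (0, 0, 0) \<and> homogeneous_syzygy d F G H s)"

definition syzygy_gap :: "'a::comm_ring_1 bpoly \<Rightarrow> 'a bpoly \<Rightarrow> 'a bpoly \<Rightarrow> int" where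
  "syzygy_gap F G H =
     int (total_degree F) + int (total_degree G) + int (total_degree H)
     - 2 * int (min_syzygy_degree F G H)"

definition cell ::
  "('n::finite \<Rightarrow> 'a::field bpoly) \<Rightarrow> 'a bpoly \<Rightarrow> 'a bpoly \<Rightarrow> 'a bpoly \<Rightarrow> bool"
where
  "cell l F G H \<longleftrightarrow>
     F \<noteq> 0 \<and> G \<noteq> 0 \<and> H \<noteq> 0 \<and> homogeneous F \<and> homogeneous G \<and> homogeneous H \<and>
     (\<forall>D. D dvd F \<and> D dvd G \<and> D dvd H * (\<Prod>i\<in>UNIV. l i) \<longrightarrow> is_unit D)"

definition p_unit_interval :: "nat \<Rightarrow> real set" where
  "p_unit_interval p = {0..1} \<inter> {of_int m / real p ^ e | m e. True}"

definition p_cube :: "nat \<Rightarrow> (real ^ 'n) set" where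
  "p_cube p = {t. \<forall>i. t $ i \<in> p_unit_interval p}"

definition grid :: "nat \<Rightarrow> (real ^ 'n) set" where
  "grid q = {t. \<forall>i. \<exists>a::nat. a \<le> q \<and> t $ i = real a / real q}"

definition adjacent :: "nat \<Rightarrow> real ^ 'n \<Rightarrow> real ^ 'n \<Rightarrow> bool" where
  "adjacent q t u \<longleftrightarrow>
     (\<exists>i. \<bar>t $ i - u $ i\<bar> = 1 / real q \<and> (\<forall>j. j \<noteq> i \<longrightarrow> t $ j = u $ j))"

definition taxicab :: "real ^ 'n \<Rightarrow> real ^ 'n \<Rightarrow> real" where
  "taxicab t u = (\<Sum>i\<in>UNIV. \<bar>t $ i - u $ i\<bar>)"

text \<open>
  The value at \<open>t = a / q\<close> is the common value of the quotients below over all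
  representations of \<open>t\<close> with denominator \<open>q\<close> a power of the characteristic. It is only
  meaningful for \<open>t\<close> in the cube \<open>p_cube CHAR('a)\<close>.
\<close>

definition cell_gap ::
  "('n::finite \<Rightarrow> 'a::field bpoly) \<Rightarrow> 'a bpoly \<Rightarrow> 'a bpoly \<Rightarrow> 'a bpoly \<Rightarrow> real ^ 'n \<Rightarrow> real"
where
  "cell_gap l F G H t = (THE v. \<forall>e q. \<forall>a :: 'n \<Rightarrow> nat.
     q = CHAR('a) ^ e \<and> (\<forall>i. a i \<le> q \<and> t $ i = real (a i) / real q) \<longrightarrow>
     v = real_of_int (syzygy_gap (F ^ q) (G ^ q) (H ^ q * (\<Prod>i\<in>UNIV. l i ^ a i))) / real q)"

text \<open>
  \<open>f\<close> is, on \<open>S\<close>, the restriction of a function that is affine on each member of a finite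
  family of convex polyhedra covering \<open>S\<close>. Requiring one function \<open>g\<close> on the whole polyhedra
  (not just on \<open>S\<close>) makes the affine pieces agree on overlaps, so that no jumps can be hidden
  outside a dense set \<open>S\<close>.
\<close>

definition piecewise_linear_on :: "'b::euclidean_space set \<Rightarrow> ('b \<Rightarrow> real) \<Rightarrow> bool" where
  "piecewise_linear_on S f \<longleftrightarrow>
     (\<exists>\<P> g. finite \<P> \<and> (\<forall>P\<in>\<P>. polyhedron P) \<and> S \<subseteq> \<Union>\<P> \<and>
        (\<forall>x\<in>S. f x = g x) \<and>
        (\<forall>P\<in>\<P>. \<exists>a b. \<forall>x\<in>P. g x = a \<bullet> x + b))"

end

theory Submission
  imports Defs "Berlekamp_Zassenhaus.Unique_Factorization_Poly"
begin

text \<open>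
  A syzygy is called primitive if its three components have no common factor. Everything rests
  on one criterion: if \<open>F\<close>, \<open>G\<close>, \<open>H\<close> have no common factor, then a primitive homogeneous syzygy of
  degree \<open>d\<close> with \<open>2 * d \<le> deg F + deg G + deg H\<close> has least degree, so that the syzygy gap can be
  read off from it (\<open>syzygy_gap_eq_primitive\<close>). The reason is the cross product of two syzygies: it
  is a polynomial multiple of \<open>(F, G, H)\<close>, and comparing degrees shows that either it vanishes, and
  then the second syzygy is a multiple of the primitive one, or the two degrees add up to at least
  \<open>deg F + deg G + deg H\<close> (\<open>syzygy_degree_dichotomy\<close>). Conversely, a count of coefficients provides a
  syzygy below this bound, and one of least degree is primitive, since otherwise a common factor
  could be cancelled (\<open>minimal_syzygy\<close>).

  Now let \<open>u = a / q\<close>, put \<open>A = F^q\<close>, \<open>B = G^q\<close>, \<open>C = H^q * l^a\<close>, and let \<open>(\<alpha>, \<beta>, \<gamma>)\<close> be a syzygy of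
  \<open>(A, B, C)\<close> of least degree. If \<open>l i\<close> divided \<open>\<gamma>\<close>, then \<open>(\<alpha>, \<beta>, \<gamma> / l i)\<close> would show that the gap does
  not drop when the \<open>i\<close>-th coordinate increases; if \<open>l i\<close> divided both \<open>\<alpha>\<close> and \<open>\<beta>\<close>, then
  \<open>(\<alpha> / l i, \<beta> / l i, \<gamma>)\<close> would show that it does not drop when that coordinate decreases. A local
  maximum excludes both wherever the respective neighbour exists.

  A point \<open>t\<close> with denominator \<open>q * r\<close> differs from \<open>u\<close> by \<open>(up - down) / (q * r)\<close> with vectors \<open>up\<close>,
  \<open>down\<close> of natural numbers with disjoint supports. As \<open>r\<close> is a power of the characteristic,
  \<open>(l^up * \<alpha>^r, l^up * \<beta>^r, l^down * \<gamma>^r)\<close> is a syzygy at \<open>t\<close>. The two divisibility conditions are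
  exactly what makes it primitive, and \<open>d(t, u) \<le> \<delta>(u)\<close> is exactly the degree bound of the
  criterion. Hence it has least degree, and its degree gives \<open>\<delta>(t) = \<delta>(u) - d(t, u)\<close>
  (\<open>syzygy_gap_power_shift\<close>, \<open>cell_gap_eq_minus_taxicab\<close>). The case \<open>up = down = 0\<close> says that the gap is
  multiplied by \<open>r\<close> when all three polynomials are raised to the power \<open>r\<close>, which is why \<open>\<delta>\<close> does not
  depend on the chosen denominator.
\<close>

(* The constant of algebraic semidoms, not its namesake from the theory of unique factorization. *)
hide_const (open) Unique_Factorization.coprime
alias coprime = Rings.coprime

section \<open>Homogeneous polynomials in two variables\<close>

lemma homogeneous_deg_iff:
  "homogeneous_deg d P \<longleftrightarrow> (\<forall>i j. coeff (coeff P j) i \<noteq> 0 \<longrightarrow> i + j = d)"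
  by (auto simp: homogeneous_deg_def monomials_def)

lemma homogeneous_deg_zero [simp]: "homogeneous_deg d 0"
  by (simp add: homogeneous_deg_iff)

lemma homogeneous_deg_one [simp]: "homogeneous_deg 0 (1 :: 'a::comm_semiring_1 bpoly)"
  by (auto simp: homogeneous_deg_iff split: if_splits)

lemma homogeneous_deg_add:
  "homogeneous_deg d P \<Longrightarrow> homogeneous_deg d Q \<Longrightarrow> homogeneous_deg d (P + Q)"
  by (auto simp: homogeneous_deg_iff) (metis add_0)

lemma homogeneous_deg_diff:
  fixes P Q :: "'a::comm_ring_1 bpoly"
  shows "homogeneous_deg d P \<Longrightarrow> homogeneous_deg d Q \<Longrightarrow> homogeneous_deg d (P - Q)"
  by (auto simp: homogeneous_deg_iff) (metis diff_zero)

lemma homogeneous_deg_sum: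
  "(\<And>x. x \<in> X \<Longrightarrow> homogeneous_deg d (f x)) \<Longrightarrow> homogeneous_deg d (\<Sum>x\<in>X. f x)"
  by (induction X rule: infinite_finite_induct) (auto intro: homogeneous_deg_add)

lemma monomials_empty_iff: "monomials P = {} \<longleftrightarrow> P = 0"
  by (auto simp: monomials_def poly_eq_iff)

lemma ex_monomial: "P \<noteq> 0 \<Longrightarrow> \<exists>i j. coeff (coeff P j) i \<noteq> 0"
  by (metis leading_coeff_0_iff)

lemma finite_monomials: "finite (monomials P)"
proof -
  have "monomials P \<subseteq> (\<Union>j\<in>{..degree P}. {..degree (coeff P j)} \<times> {j})"
  proof
    fix m assume "m \<in> monomials P"
    then obtain i j where m: "m = (i, j)" and nz: "coeff (coeff P j) i \<noteq> 0"
      by (auto simp: monomials_def)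
    from nz have "coeff P j \<noteq> 0" by auto
    with nz show "m \<in> (\<Union>j\<in>{..degree P}. {..degree (coeff P j)} \<times> {j})"
      by (auto simp: m intro: le_degree)
  qed
  then show ?thesis
    by (rule finite_subset) auto
qed

lemma total_degree_eq:
  assumes "homogeneous_deg d P" "P \<noteq> 0"
  shows "total_degree P = d"
proof -
  have "(\<lambda>(i, j). i + j) ` monomials P = {d}"
    using assms monomials_empty_iff[of P] by (force simp: homogeneous_deg_def)
  then show ?thesis by (simp add: total_degree_def)
qed

lemma homogeneous_deg_unique:
  "homogeneous_deg d P \<Longrightarrow> homogeneous_deg e P \<Longrightarrow> P \<noteq> 0 \<Longrightarrow> d = e"
  using total_degree_eq by metis

lemma coeff_coeff_mult:
  "coeff (coeff (P * Q) j) i =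
     (\<Sum>k\<le>j. \<Sum>m\<le>i. coeff (coeff P k) m * coeff (coeff Q (j - k)) (i - m))"
  by (simp add: coeff_mult coeff_sum)

lemma monomial_of_mult:
  assumes "coeff (coeff (P * Q) j) i \<noteq> 0"
  obtains i1 j1 i2 j2 where "coeff (coeff P j1) i1 \<noteq> 0" "coeff (coeff Q j2) i2 \<noteq> 0"
    "i = i1 + i2" "j = j1 + j2"
proof -
  from assms obtain k m where "k \<le> j" "m \<le> i"
    "coeff (coeff P k) m * coeff (coeff Q (j - k)) (i - m) \<noteq> 0"
    unfolding coeff_coeff_mult by (metis (no_types, lifting) atMost_iff sum.neutral)
  then show ?thesis
    using that[of k m "j - k" "i - m"] by (metis le_add_diff_inverse mult_zero_left mult_zero_right)
qed

lemma homogeneous_deg_mult: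
  assumes "homogeneous_deg a P" "homogeneous_deg b Q"
  shows "homogeneous_deg (a + b) (P * Q)"
  unfolding homogeneous_deg_iff
proof (intro allI impI)
  fix i j assume "coeff (coeff (P * Q) j) i \<noteq> 0"
  then show "i + j = a + b"
    by (rule monomial_of_mult) (use assms in \<open>force simp: homogeneous_deg_iff\<close>)
qed

lemma homogeneous_deg_power:
  fixes P :: "'a::comm_semiring_1 bpoly"
  shows "homogeneous_deg a P \<Longrightarrow> homogeneous_deg (n * a) (P ^ n)"
  by (induction n) (auto intro: homogeneous_deg_mult)

lemma homogeneous_deg_prod:
  fixes f :: "'i \<Rightarrow> 'a::comm_semiring_1 bpoly"
  assumes "\<And>x. x \<in> X \<Longrightarrow> homogeneous_deg (d x) (f x)"
  shows "homogeneous_deg (\<Sum>x\<in>X. d x) (\<Prod>x\<in>X. f x)"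
  using assms by (induction X rule: infinite_finite_induct) (auto intro: homogeneous_deg_mult)

text \<open>
  Used to split off the extremal homogeneous component of a polynomial.
\<close>

lemma ex_restrict_monomials:
  fixes P :: "'a::comm_ring_1 bpoly"
  obtains P0 where "\<And>i j. coeff (coeff P0 j) i = (if S i j then coeff (coeff P j) i else 0)"
proof
  fix i j
  show "coeff (coeff (\<Sum>j\<le>degree P. monom (\<Sum>i\<le>degree (coeff P j).
      monom (if S i j then coeff (coeff P j) i else 0) i) j) j) i =
     (if S i j then coeff (coeff P j) i else 0)"
    by (cases "j \<le> degree P"; cases "i \<le> degree (coeff P j)")
       (auto simp: coeff_sum coeff_eq_0 if_distrib[of "\<lambda>p. coeff p _"] cong: if_cong)
qed

text \<open>
  For \<open>s = 1\<close> this says that total degrees of top components add up, for \<open>s = -1\<close> the same for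
  bottom components: the product of the components of largest weight \<open>s * (i + j)\<close> is nonzero,
  and all other products of components have smaller weight, so they cannot cancel it.
\<close>

lemma monomial_of_mult_extremal:
  fixes P Q :: "'a::idom bpoly" and s :: int
  assumes P: "coeff (coeff P j1) i1 \<noteq> 0" and Q: "coeff (coeff Q j2) i2 \<noteq> 0"
  obtains i j where "coeff (coeff (P * Q) j) i \<noteq> 0"
    "s * (int i1 + int j1) + s * (int i2 + int j2) \<le> s * (int i + int j)"
proof -
  define w where "w = (\<lambda>(i::nat, j::nat). s * (int i + int j))"
  have split: "\<exists>M R0. M \<ge> w (i1, j1) \<and> R0 \<noteq> 0
      \<and> (\<forall>i j. coeff (coeff R0 j) i \<noteq> 0 \<longrightarrow> w (i, j) = M)
      \<and> (\<forall>i j. coeff (coeff (R - R0) j) i \<noteq> 0 \<longrightarrow> w (i, j) < M)"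
    if R: "coeff (coeff R j1) i1 \<noteq> 0" for R :: "'a bpoly" and i1 j1
  proof -
    have fin: "finite (w ` monomials R)" and ne: "(i1, j1) \<in> monomials R"
      using finite_monomials R by (auto simp: monomials_def)
    define M where "M = Max (w ` monomials R)"
    obtain R0 where R0: "\<And>i j. coeff (coeff R0 j) i =
        (if w (i, j) = M then coeff (coeff R j) i else 0)"
      using ex_restrict_monomials[of "\<lambda>i j. w (i, j) = M" R] by metis
    have "M \<in> w ` monomials R"
      using Max_in[OF fin] ne by (auto simp: M_def)
    then obtain i j where "(i, j) \<in> monomials R" "w (i, j) = M" by auto
    then have "coeff (coeff R0 j) i \<noteq> 0" by (simp add: R0 monomials_def)
    then have "R0 \<noteq> 0" by auto
    moreover have le: "w (i, j) \<le> M" if "coeff (coeff R j) i \<noteq> 0" for i j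
      using Max_ge[OF fin] that by (auto simp: M_def monomials_def)
    moreover have "w (i, j) < M" if "coeff (coeff (R - R0) j) i \<noteq> 0" for i j
      using that le[of j i] by (auto simp: R0 split: if_splits)
    ultimately show ?thesis
      using R by (intro exI[of _ M] exI[of _ R0]) (auto simp: R0)
  qed
  from split[OF P] obtain M P0 where P0: "M \<ge> w (i1, j1)" "P0 \<noteq> 0"
    "\<And>i j. coeff (coeff P0 j) i \<noteq> 0 \<Longrightarrow> w (i, j) = M"
    "\<And>i j. coeff (coeff (P - P0) j) i \<noteq> 0 \<Longrightarrow> w (i, j) < M" by blast
  from split[OF Q] obtain N Q0 where Q0: "N \<ge> w (i2, j2)" "Q0 \<noteq> 0"
    "\<And>i j. coeff (coeff Q0 j) i \<noteq> 0 \<Longrightarrow> w (i, j) = N"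
    "\<And>i j. coeff (coeff (Q - Q0) j) i \<noteq> 0 \<Longrightarrow> w (i, j) < N" by blast
  have w_add: "w (i + i', j + j') = w (i, j) + w (i', j')" for i i' j j'
    by (simp add: w_def algebra_simps)
  obtain i j where ij: "coeff (coeff (P0 * Q0) j) i \<noteq> 0"
    using ex_monomial[of "P0 * Q0"] P0(2) Q0(2) by auto
  then have wij: "w (i, j) = M + N"
    by (rule monomial_of_mult) (use P0(3) Q0(3) in \<open>simp add: w_add\<close>)
  have z1: "coeff (coeff (P0 * (Q - Q0)) j) i = 0"
  proof (rule ccontr)
    assume "\<not> ?thesis"
    then have "w (i, j) < M + N"
      by (rule monomial_of_mult) (use P0(3) Q0(4) in \<open>fastforce simp: w_add\<close>)
    with wij show False by simp
  qed
  have Q_le: "w (i, j) \<le> N" if "coeff (coeff Q j) i \<noteq> 0" for i j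
  proof -
    have "coeff (coeff Q0 j) i \<noteq> 0 \<or> coeff (coeff (Q - Q0) j) i \<noteq> 0" using that by auto
    then show ?thesis using Q0(3,4)[of j i] by fastforce
  qed
  have z2: "coeff (coeff ((P - P0) * Q) j) i = 0"
  proof (rule ccontr)
    assume "\<not> ?thesis"
    then have "w (i, j) < M + N"
      by (rule monomial_of_mult) (use P0(4) Q_le in \<open>fastforce simp: w_add\<close>)
    with wij show False by simp
  qed
  have "P * Q = P0 * Q0 + P0 * (Q - Q0) + (P - P0) * Q"
    by (simp add: algebra_simps)
  then have "coeff (coeff (P * Q) j) i = coeff (coeff (P0 * Q0) j) i"
    using z1 z2 by simp
  then show ?thesis
    using that[of j i] ij wij P0(1) Q0(1) by (simp add: w_def)
qed

text \<open>
  A monomial of \<open>P\<close> and one of \<open>Q\<close> have total degrees adding up to at most the top degree and at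
  least the bottom degree of \<open>P * Q\<close>, and these coincide.
\<close>

lemma homogeneous_factor:
  fixes P Q :: "'a::idom bpoly"
  assumes "homogeneous_deg d (P * Q)" "P * Q \<noteq> 0"
  obtains a b where "homogeneous_deg a P" "homogeneous_deg b Q" "a + b = d"
proof -
  have sum_eq: "(i1 + j1) + (i2 + j2) = d"
    if "coeff (coeff P j1) i1 \<noteq> 0" "coeff (coeff Q j2) i2 \<noteq> 0" for i1 j1 i2 j2
  proof (rule antisym)
    show "(i1 + j1) + (i2 + j2) \<le> d"
      by (rule monomial_of_mult_extremal[OF that, of 1])
         (use assms in \<open>force simp: homogeneous_deg_iff\<close>)
    show "d \<le> (i1 + j1) + (i2 + j2)"
      by (rule monomial_of_mult_extremal[OF that, of "-1"])
         (use assms in \<open>force simp: homogeneous_deg_iff\<close>)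
  qed
  from assms obtain i j i' j' where "coeff (coeff P j) i \<noteq> 0" "coeff (coeff Q j') i' \<noteq> 0"
    using ex_monomial[of P] ex_monomial[of Q] by auto
  with sum_eq show ?thesis
    using that[of "i + j" "i' + j'"] unfolding homogeneous_deg_iff by (metis add_right_cancel add_left_cancel)
qed

lemma homogeneous_deg_cancel:
  fixes P Q :: "'a::idom bpoly"
  assumes "homogeneous_deg d (P * Q)" "homogeneous_deg a P" "P * Q \<noteq> 0"
  shows "homogeneous_deg (d - a) Q" "a \<le> d"
proof -
  obtain a' b where "homogeneous_deg a' P" "homogeneous_deg b Q" "a' + b = d"
    using homogeneous_factor assms by metis
  moreover from this have "a' = a"
    using assms homogeneous_deg_unique by fastforce
  ultimately show "homogeneous_deg (d - a) Q" "a \<le> d" by auto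
qed

lemma is_unit_of_homogeneous_deg_0:
  fixes P :: "'a::field bpoly"
  assumes "homogeneous_deg 0 P" "P \<noteq> 0"
  shows "is_unit P"
proof -
  define c where "c = coeff (coeff P 0) 0"
  have coeff: "coeff (coeff P j) i = 0" if "i + j \<noteq> 0" for i j
    using assms(1) that unfolding homogeneous_deg_iff by blast
  have P: "P = [:[:c:]:]"
    by (intro poly_eqI) (simp add: c_def coeff_pCons coeff split: nat.split)
  with assms(2) have "c \<noteq> 0" by auto
  then have "P * [:[:inverse c:]:] = 1" by (simp add: P)
  then show ?thesis by (metis dvd_triv_left)
qed

text \<open>
  In a factorization of a linear form one factor has degree \<open>0\<close>, hence is a unit; and irreducible
  elements of a unique factorization domain are prime.
\<close>

lemma prime_elem_linear_form:
  fixes l :: "'a::field bpoly"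
  assumes "linear_form l"
  shows "prime_elem l"
proof -
  have l: "l \<noteq> 0" "homogeneous_deg 1 l" using assms by (auto simp: linear_form_def)
  have factor: "is_unit x \<or> is_unit y" if xy: "l = x * y" for x y
  proof -
    obtain a b where ab: "homogeneous_deg a x" "homogeneous_deg b y" "a + b = 1"
      using homogeneous_factor[of 1 x y] l xy by metis
    then have "a = 0 \<or> b = 0" by auto
    moreover have "x \<noteq> 0" "y \<noteq> 0" using l xy by auto
    ultimately show ?thesis using ab is_unit_of_homogeneous_deg_0 by blast
  qed
  have "\<not> is_unit l"
  proof
    assume "is_unit l"
    then obtain y where y: "1 = l * y" by (rule dvdE)
    have "homogeneous_deg 0 (l * y)" unfolding y[symmetric] by (rule homogeneous_deg_one)
    moreover have "l * y \<noteq> 0" unfolding y[symmetric] by simp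
    ultimately show False using homogeneous_deg_cancel(2)[of 0 l y 1] l by simp
  qed
  then have "irreducible l" using l(1) factor by (intro irreducibleI)
  then show ?thesis by simp
qed

lemma homogeneous_deg_prod_linear_forms:
  fixes l :: "'n::finite \<Rightarrow> 'a::field bpoly"
  assumes "\<And>i. linear_form (l i)"
  shows "homogeneous_deg (\<Sum>i\<in>UNIV. n i) (\<Prod>i\<in>UNIV. l i ^ n i)" "(\<Prod>i\<in>UNIV. l i ^ n i) \<noteq> 0"
proof -
  have "homogeneous_deg (n i * 1) (l i ^ n i)" for i
    using assms by (intro homogeneous_deg_power) (auto simp: linear_form_def)
  then show "homogeneous_deg (\<Sum>i\<in>UNIV. n i) (\<Prod>i\<in>UNIV. l i ^ n i)"
    by (intro homogeneous_deg_prod) simp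
  show "(\<Prod>i\<in>UNIV. l i ^ n i) \<noteq> 0"
    using assms by (auto simp: linear_form_def)
qed

section \<open>Common factors in unique factorization domains\<close>

lemma prime_elem_divisor_exists:
  fixes x :: "'a::ufd"
  assumes "x \<noteq> 0" "\<not> x dvd 1"
  obtains p where "prime_elem p" "p dvd x"
proof -
  from mset_factors_exist[OF assms] obtain M where M: "mset_factors M x" ..
  then obtain p where p: "p \<in># M" by (auto simp: mset_factors_def)
  with M have "irreducible p" by (auto simp: mset_factors_def)
  moreover have "p dvd x" using mset_factors_imp_dvd[OF M p] .
  ultimately show ?thesis using that by auto
qed

definition common_factor_free :: "'a::comm_semiring_1 \<Rightarrow> 'a \<Rightarrow> 'a \<Rightarrow> bool" where
  "common_factor_free a b c \<longleftrightarrow> (\<forall>x. x dvd a \<and> x dvd b \<and> x dvd c \<longrightarrow> x dvd 1)"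

lemma common_factor_freeI_prime:
  fixes a b c :: "'a::ufd"
  assumes "(a, b, c) \<noteq> (0, 0, 0)"
    and "\<And>p. prime_elem p \<Longrightarrow> p dvd a \<Longrightarrow> p dvd b \<Longrightarrow> p dvd c \<Longrightarrow> False"
  shows "common_factor_free a b c"
  unfolding common_factor_free_def
proof (intro allI impI)
  fix x assume x: "x dvd a \<and> x dvd b \<and> x dvd c"
  show "x dvd 1"
  proof (rule ccontr)
    assume "\<not> x dvd 1"
    moreover have "x \<noteq> 0" using x assms(1) by auto
    ultimately obtain p where "prime_elem p" "p dvd x"
      using prime_elem_divisor_exists by metis
    then show False using assms(2) x by (meson dvd_trans)
  qed
qed

lemma common_factor_freeD_prime:
  "common_factor_free a b c \<Longrightarrow> prime_elem p \<Longrightarrow> p dvd a \<Longrightarrow> p dvd b \<Longrightarrow> \<not> p dvd c"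
  by (auto simp: common_factor_free_def prime_elem_def)

text \<open>
  \<open>f\<close> divides \<open>a * gcd(f, b, c)\<close>, and this gcd is a unit.
\<close>

lemma common_factor_free_dvdI:
  fixes a b c f :: "'a::ufd"
  assumes free: "common_factor_free f b c"
    and dvd: "f dvd a * b" "f dvd a * c"
  shows "f dvd a"
proof -
  define g where "g = some_gcd f (some_gcd b c)"
  have "f dvd b * a" "f dvd c * a" using dvd by (simp_all add: mult.commute)
  then have "f dvd some_gcd b c * a"
    by (rule some_gcd.gcd_greatest_mult)
  with dvd_triv_left have "f dvd g * a"
    unfolding g_def by (rule some_gcd.gcd_greatest_mult)
  moreover have g: "g dvd f" "g dvd some_gcd b c"
    unfolding g_def by (rule some_gcd.gcd_dvd1, rule some_gcd.gcd_dvd2)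
  have "g dvd b" "g dvd c"
    using dvd_trans[OF g(2) some_gcd.gcd_dvd1] dvd_trans[OF g(2) some_gcd.gcd_dvd2] .
  with g(1) have "g dvd 1" using free by (simp add: common_factor_free_def)
  then have "g * a dvd 1 * a" by (rule mult_dvd_mono) simp
  ultimately show ?thesis
    using dvd_trans[of f "g * a" a] by simp
qed

text \<open>
  The ratio of two proportional vectors is a fraction; its denominator divides every entry of the
  second vector, so it is a unit if these entries have no common factor.
\<close>

lemma parallel_imp_multiple:
  fixes a b c u v w :: "'a::ufd"
  assumes free: "common_factor_free a b c" and nz: "(a, b, c) \<noteq> (0, 0, 0)"
    and par: "u * b = v * a" "u * c = w * a" "v * c = w * b"
  obtains h where "u = h * a" "v = h * b" "w = h * c"
proof -
  have *: "\<exists>h. u = h * a \<and> v = h * b \<and> w = h * c"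
    if "common_factor_free a b c" "a \<noteq> 0" "u * b = v * a" "u * c = w * a"
    for a b c u v w :: 'a
  proof -
    have "a dvd u"
      by (rule common_factor_free_dvdI[OF that(1)]) (simp_all add: that(3,4))
    then obtain h where h: "u = h * a" by (metis dvd_def mult.commute)
    with that have "v * a = (h * b) * a" "w * a = (h * c) * a"
      by (simp_all only: ac_simps)
    with that(2) h show ?thesis by auto
  qed
  from nz consider "a \<noteq> 0" | "b \<noteq> 0" | "c \<noteq> 0" by auto
  then show ?thesis
  proof cases
    case 1
    from *[OF free 1 par(1,2)] that show ?thesis by blast
  next
    case 2
    have "common_factor_free b a c" using free unfolding common_factor_free_def by blast
    from *[OF this 2 par(1)[symmetric] par(3)] that show ?thesis by blast
  next
    case 3
    have "common_factor_free c a b" using free unfolding common_factor_free_def by blast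
    from *[OF this 3 par(2)[symmetric] par(3)[symmetric]] that show ?thesis by blast
  qed
qed

lemma common_factor_free_same_primes:
  fixes a b c :: "'a::ufd"
  assumes free: "common_factor_free a b c" and nz: "a' \<noteq> 0"
    and "\<And>p. prime_elem p \<Longrightarrow> p dvd a' \<Longrightarrow> p dvd a"
    and "\<And>p. prime_elem p \<Longrightarrow> p dvd b' \<Longrightarrow> p dvd b"
    and "\<And>p. prime_elem p \<Longrightarrow> p dvd c' \<Longrightarrow> p dvd c"
  shows "common_factor_free a' b' c'"
proof (rule common_factor_freeI_prime)
  fix p assume p: "prime_elem p" "p dvd a'" "p dvd b'" "p dvd c'"
  show False
    using common_factor_freeD_prime[OF free p(1) assms(3)[OF p(1,2)] assms(4)[OF p(1,3)]]
      assms(5)[OF p(1,4)] by (rule notE)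
qed (use nz in simp)

lemma prime_elem_dvd_imp_dvd:
  fixes p q :: "'a::ufd"
  assumes "prime_elem p" "prime_elem q" "p dvd q"
  shows "q dvd p"
proof -
  obtain x where x: "q = p * x" using assms(3) by (rule dvdE)
  have "irreducible q" using assms(2) by simp
  then have "p dvd 1 \<or> x dvd 1" by (rule irreducibleD) (rule x)
  then obtain y where "x * y = 1" using prime_elem_not_unit[OF assms(1)] by (metis dvdE)
  then have "p = q * y" using x by (simp add: mult.assoc)
  then show ?thesis by simp
qed

lemma prime_elem_dvd_prod_power:
  fixes f :: "'i \<Rightarrow> 'a::ufd"
  assumes p: "prime_elem p" and "p dvd (\<Prod>i\<in>I. f i ^ n i)"
  obtains i where "i \<in> I" "n i > 0" "p dvd f i"
proof -
  have "\<exists>i\<in>I. p dvd f i ^ n i"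
    using assms(2)
  proof (induction I rule: infinite_finite_induct)
    case (insert x I)
    then have "p dvd f x ^ n x * (\<Prod>i\<in>I. f i ^ n i)" by simp
    then show ?case using insert.IH prime_elem_dvd_multD[OF p] by blast
  qed (use prime_elem_not_unit[OF p] in auto)
  then obtain i where i: "i \<in> I" "p dvd f i ^ n i" by auto
  then have "n i > 0" using prime_elem_not_unit[OF p] by (cases "n i") auto
  moreover have "p dvd f i" using prime_elem_dvd_power[OF p] i(2) by blast
  ultimately show ?thesis using that i(1) by blast
qed

section \<open>Syzygies of least degree\<close>

text \<open>
  Gaussian elimination: an equation with a nonzero coefficient removes one unknown together
  with itself.
\<close>

lemma underdetermined_system_solvable:
  fixes A :: "'e \<Rightarrow> 'i \<Rightarrow> 'k::field"
  assumes "finite E" "finite I" "card E < card I"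
  shows "\<exists>v. (\<exists>i\<in>I. v i \<noteq> 0) \<and> (\<forall>e\<in>E. (\<Sum>i\<in>I. A e i * v i) = 0)"
  using assms
proof (induction E arbitrary: I A rule: finite_induct)
  case empty
  then have "I \<noteq> {}" by auto
  then show ?case by (intro exI[of _ "\<lambda>_. 1"]) auto
next
  case (insert e E)
  show ?case
  proof (cases "\<forall>i\<in>I. A e i = 0")
    case True
    obtain v where "\<exists>i\<in>I. v i \<noteq> 0" "\<forall>e\<in>E. (\<Sum>i\<in>I. A e i * v i) = 0"
      using insert.IH[of I A] insert.prems insert.hyps by auto
    with True show ?thesis by (intro exI[of _ v]) auto
  next
    case False
    then obtain j where j: "j \<in> I" "A e j \<noteq> 0" by auto
    define A' where "A' = (\<lambda>f i. A f i - A f j * A e i / A e j)"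
    have card: "card E < card (I - {j})" "finite (I - {j})"
      using insert.prems insert.hyps j by auto
    obtain v where v: "\<exists>i\<in>I - {j}. v i \<noteq> 0" "\<forall>f\<in>E. (\<Sum>i\<in>I - {j}. A' f i * v i) = 0"
      using insert.IH[OF card(2,1)] by blast
    define x where "x = - (\<Sum>i\<in>I - {j}. A e i * v i) / A e j"
    have split: "(\<Sum>i\<in>I. A f i * (v(j := x)) i) = A f j * x + (\<Sum>i\<in>I - {j}. A f i * v i)" for f
    proof -
      have "(\<Sum>i\<in>I. A f i * (v(j := x)) i)
          = A f j * x + (\<Sum>i\<in>I - {j}. A f i * (v(j := x)) i)"
        using insert.prems(1) j(1) by (subst sum.remove[of _ j]) auto
      also have "(\<Sum>i\<in>I - {j}. A f i * (v(j := x)) i) = (\<Sum>i\<in>I - {j}. A f i * v i)"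
        by (intro sum.cong) auto
      finally show ?thesis .
    qed
    have "(\<Sum>i\<in>I. A f i * (v(j := x)) i) = 0" if "f \<in> E" for f
    proof -
      have "0 = (\<Sum>i\<in>I - {j}. A f i * v i - A f j / A e j * (A e i * v i))"
        using v(2) that by (auto simp: A'_def algebra_simps)
      also have "\<dots> = (\<Sum>i\<in>I - {j}. A f i * v i) - A f j / A e j * (\<Sum>i\<in>I - {j}. A e i * v i)"
        by (simp add: sum_subtractf sum_distrib_left)
      also have "\<dots> = A f j * x + (\<Sum>i\<in>I - {j}. A f i * v i)"
        by (simp add: x_def)
      finally show ?thesis using split by simp
    qed
    moreover have "(\<Sum>i\<in>I. A e i * (v(j := x)) i) = 0"
      unfolding split using j(2) by (simp add: x_def)
    moreover have "\<exists>i\<in>I. (v(j := x)) i \<noteq> 0"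
      using v(1) by auto
    ultimately show ?thesis
      by (intro exI[of _ "v(j := x)"]) auto
  qed
qed

lemma homogeneous_deg_monom: "homogeneous_deg (i + j) (monom (monom c i) j)"
  by (auto simp: homogeneous_deg_iff split: if_splits)

lemma homogeneous_deg_imp_homogeneous: "homogeneous_deg d P \<Longrightarrow> homogeneous P"
  by (auto simp: homogeneous_def)

text \<open>
  The coefficients of a syzygy of degree \<open>d\<close> are subject to \<open>d + 1\<close> linear equations, one for each
  monomial of degree \<open>d\<close>, while the number of coefficients is at least
  \<open>3 * (d + 1) - (a + b + c)\<close>. By hypothesis there are more unknowns than equations.
\<close>

lemma homogeneous_syzygy_exists:
  fixes F G H :: "'a::field bpoly"
  assumes hom: "homogeneous_deg a F" "homogeneous_deg b G" "homogeneous_deg c H"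
    and d: "a + b + c < 2 * d + 2"
  shows "\<exists>s. s \<noteq> (0, 0, 0) \<and> homogeneous_syzygy d F G H s"
proof -
  (* The unknown v (s, k) is the coefficient of y^k in the s-th component, and B (s, k) is the
     contribution of this unknown to the sum that has to vanish. A form of degree d is determined
     by its coefficients cf _ j at x^(d - j) y^j. If t s > d, then there are no unknowns
     for the index s and that component is 0. *)
  define T where "T = (\<lambda>s::nat. if s = 0 then F else if s = 1 then G else H)"
  define t where "t = (\<lambda>s::nat. if s = 0 then a else if s = 1 then b else c)"
  define I where "I = (SIGMA s:{0, 1, 2::nat}. {..<d + 1 - t s})"
  define B where "B = (\<lambda>(s, k). monom (monom 1 (d - t s - k)) k * T s)"
  define cf where "cf = (\<lambda>P :: 'a bpoly. \<lambda>j. coeff (coeff P j) (d - j))"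
  have T: "homogeneous_deg (t s) (T s)" for s
    using hom by (simp add: T_def t_def)
  have "card I = (d + 1 - a) + ((d + 1 - b) + (d + 1 - c))"
    by (simp add: I_def t_def)
  then have "card {..d} < card I" "finite I"
    using d by (auto simp: I_def)
  then obtain v where v: "\<exists>i\<in>I. v i \<noteq> 0" "\<forall>j\<in>{..d}. (\<Sum>i\<in>I. cf (B i) j * v i) = 0"
    using underdetermined_system_solvable[of "{..d}" I "\<lambda>j i. cf (B i) j"] by auto
  define S where "S = (\<lambda>s. \<Sum>k<d + 1 - t s. monom (monom (v (s, k)) (d - t s - k)) k)"
  have coeff_S: "coeff (coeff (S s) k) (d - t s - k) = (if k < d + 1 - t s then v (s, k) else 0)" for s k
    by (auto simp: S_def coeff_sum sum.If_cases if_distrib[of "\<lambda>p. coeff p _"] cong: if_cong)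
  have hom_S: "homogeneous_deg (d - t s) (S s)" for s
    unfolding S_def
  proof (intro homogeneous_deg_sum)
    fix k assume "k \<in> {..<d + 1 - t s}"
    then have "d - t s = d - t s - k + k" by auto
    then show "homogeneous_deg (d - t s) (monom (monom (v (s, k)) (d - t s - k)) k)"
      using homogeneous_deg_monom by metis
  qed
  have hom_ST: "homogeneous_deg d (S s * T s)" for s
  proof (cases "t s \<le> d")
    case True
    then show ?thesis using homogeneous_deg_mult[OF hom_S T, of s s] by simp
  next
    case False
    then have "S s = 0" by (simp add: S_def)
    then show ?thesis by simp
  qed
  define R where "R = S 0 * T 0 + S 1 * T 1 + S 2 * T 2"
  have "cf R j = (\<Sum>i\<in>I. cf (B i) j * v i)" for j
  proof -
    have *: "cf (S s * T s) j = (\<Sum>k<d + 1 - t s. cf (B (s, k)) j * v (s, k))" for s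
    proof -
      have "S s * T s = (\<Sum>k<d + 1 - t s. [:[:v (s, k):]:] * B (s, k))"
        by (simp add: S_def B_def sum_distrib_right smult_monom flip: mult.assoc)
      also have "cf \<dots> j = (\<Sum>k<d + 1 - t s. v (s, k) * cf (B (s, k)) j)"
        by (simp add: cf_def coeff_sum)
      finally show ?thesis by (simp add: mult.commute)
    qed
    have "(\<Sum>i\<in>I. cf (B i) j * v i)
       = (\<Sum>s\<in>{0, 1, 2::nat}. \<Sum>k<d + 1 - t s. cf (B (s, k)) j * v (s, k))"
      unfolding I_def by (subst sum.Sigma) auto
    also have "\<dots> = cf (S 0 * T 0) j + (cf (S 1 * T 1) j + cf (S 2 * T 2) j)"
      by (simp add: *)
    finally show ?thesis by (simp add: R_def cf_def)
  qed
  with v(2) have cf_R: "coeff (coeff R j) (d - j) = 0" if "j \<le> d" for j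
    using that by (simp add: cf_def)
  have "homogeneous_deg d R"
    unfolding R_def by (intro homogeneous_deg_add hom_ST)
  have "coeff (coeff R j) i = 0" for i j
  proof (cases "i + j = d")
    case True
    then have "i = d - j" "j \<le> d" by auto
    then show ?thesis using cf_R by simp
  next
    case False
    then show ?thesis using \<open>homogeneous_deg d R\<close> by (auto simp: homogeneous_deg_iff)
  qed
  then have "R = 0" by (simp add: poly_eq_iff)
  then have R0: "S 0 * F + S 1 * G + S 2 * H = 0" by (simp add: R_def T_def)
  from v(1) obtain s k where "s \<in> {0, 1, 2}" "k < d + 1 - t s" "v (s, k) \<noteq> 0"
    by (auto simp: I_def)
  then have "S s \<noteq> 0" using coeff_S[of s k] by auto
  then have "(S 0, S 1, S 2) \<noteq> (0, 0, 0)" using \<open>s \<in> {0, 1, 2}\<close> by auto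
  have hom_Ss: "homogeneous (S s)" for s
    using hom_S homogeneous_deg_imp_homogeneous by blast
  have ST: "homogeneous_deg d (S 0 * F)" "homogeneous_deg d (S 1 * G)" "homogeneous_deg d (S 2 * H)"
    using hom_ST[of 0] hom_ST[of 1] hom_ST[of 2] by (simp_all add: T_def)
  have "homogeneous_syzygy d F G H (S 0, S 1, S 2)"
    unfolding homogeneous_syzygy_def prod.case by (intro conjI R0 hom_Ss ST)
  with \<open>(S 0, S 1, S 2) \<noteq> (0, 0, 0)\<close> show ?thesis by (intro exI[of _ "(S 0, S 1, S 2)"] conjI)
qed

lemma homogeneous_syzygy_divide_common_factor:
  fixes F G H P \<alpha> \<beta> \<gamma> :: "'a::field bpoly"
  assumes nz: "F \<noteq> 0" "G \<noteq> 0" "H \<noteq> 0"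
    and P: "homogeneous_deg x P" "P \<noteq> 0"
    and s: "(\<alpha>, \<beta>, \<gamma>) \<noteq> (0, 0, 0)" "homogeneous_syzygy d F G H (P * \<alpha>, P * \<beta>, P * \<gamma>)"
  shows "x \<le> d" "homogeneous_syzygy (d - x) F G H (\<alpha>, \<beta>, \<gamma>)"
proof -
  have eq: "P * (\<alpha> * F + \<beta> * G + \<gamma> * H) = 0"
    using s(2) by (simp add: homogeneous_syzygy_def algebra_simps)
  have deg: "homogeneous \<delta> \<and> homogeneous_deg (d - x) (\<delta> * K) \<and> (\<delta> \<noteq> 0 \<longrightarrow> x \<le> d)"
    if "homogeneous (P * \<delta>)" "homogeneous_deg d (P * \<delta> * K)" "K \<noteq> 0" for \<delta> K
  proof (cases "\<delta> = 0")
    case True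
    then show ?thesis by (auto simp: homogeneous_def)
  next
    case False
    then have "P * \<delta> * K \<noteq> 0" "P * \<delta> \<noteq> 0" using P that by auto
    then show ?thesis
      using that homogeneous_deg_cancel[of d P "\<delta> * K" x] homogeneous_deg_cancel[of _ P \<delta> x] P
      by (auto simp: homogeneous_def mult.assoc)
  qed
  have s': "homogeneous (P * \<alpha>)" "homogeneous (P * \<beta>)" "homogeneous (P * \<gamma>)"
    "homogeneous_deg d (P * \<alpha> * F)" "homogeneous_deg d (P * \<beta> * G)" "homogeneous_deg d (P * \<gamma> * H)"
    using s(2) by (auto simp: homogeneous_syzygy_def)
  note degs = deg[OF s'(1,4) nz(1)] deg[OF s'(2,5) nz(2)] deg[OF s'(3,6) nz(3)]
  show "x \<le> d" using degs s(1) by auto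
  show "homogeneous_syzygy (d - x) F G H (\<alpha>, \<beta>, \<gamma>)"
    using degs eq P(2) by (simp add: homogeneous_syzygy_def)
qed

lemma min_syzygy_degree_le:
  "s \<noteq> (0, 0, 0) \<Longrightarrow> homogeneous_syzygy d F G H s \<Longrightarrow> min_syzygy_degree F G H \<le> d"
  unfolding min_syzygy_degree_def by (rule Least_le) blast

lemma common_factor_free_nonzero:
  "common_factor_free a b (c :: 'a::comm_ring_1 poly) \<Longrightarrow> (a, b, c) \<noteq> (0, 0, 0)"
  unfolding common_factor_free_def by (metis Pair_inject dvd_0_right dvd_0_left_iff zero_neq_one)

text \<open>
  The degree bound comes from counting coefficients. A prime common factor of the components is
  homogeneous of positive degree, being a nonunit factor of a form, so cancelling it would lower
  the degree.
\<close>

lemma minimal_syzygy: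
  fixes F G H :: "'a::field bpoly"
  assumes nz: "F \<noteq> 0" "G \<noteq> 0" "H \<noteq> 0"
    and hom: "homogeneous_deg a F" "homogeneous_deg b G" "homogeneous_deg c H"
  obtains \<alpha> \<beta> \<gamma> where "homogeneous_syzygy (min_syzygy_degree F G H) F G H (\<alpha>, \<beta>, \<gamma>)"
    "common_factor_free \<alpha> \<beta> \<gamma>" "2 * min_syzygy_degree F G H \<le> a + b + c"
proof -
  let ?P = "\<lambda>d. \<exists>s. s \<noteq> (0, 0, 0) \<and> homogeneous_syzygy d F G H s"
  define m where "m = min_syzygy_degree F G H"
  have ex: "?P ((a + b + c) div 2)"
    by (rule homogeneous_syzygy_exists[OF hom]) linarith
  then obtain s where s: "s \<noteq> (0, 0, 0)" "homogeneous_syzygy m F G H s"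
    using LeastI[of ?P, OF ex] unfolding m_def min_syzygy_degree_def by blast
  obtain \<alpha> \<beta> \<gamma> where [simp]: "s = (\<alpha>, \<beta>, \<gamma>)" by (cases s) auto
  have "m \<le> (a + b + c) div 2"
    using ex min_syzygy_degree_le unfolding m_def by blast
  moreover have "common_factor_free \<alpha> \<beta> \<gamma>"
  proof (rule common_factor_freeI_prime)
    show "(\<alpha>, \<beta>, \<gamma>) \<noteq> (0, 0, 0)" using s by simp
    fix p assume p: "prime_elem p" "p dvd \<alpha>" "p dvd \<beta>" "p dvd \<gamma>"
    then obtain \<alpha>' \<beta>' \<gamma>' where eq: "\<alpha> = p * \<alpha>'" "\<beta> = p * \<beta>'" "\<gamma> = p * \<gamma>'"
      by (meson dvdE)
    have nz': "(\<alpha>', \<beta>', \<gamma>') \<noteq> (0, 0, 0)" using s by (auto simp: eq)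
    have "\<exists>\<delta>. \<delta> \<noteq> 0 \<and> p dvd \<delta> \<and> homogeneous \<delta>"
      using s p by (auto simp: homogeneous_syzygy_def)
    then obtain \<epsilon> where "p * \<epsilon> \<noteq> 0" "homogeneous (p * \<epsilon>)"
      by (metis dvdE)
    then obtain x where x: "homogeneous_deg x p"
      by (metis homogeneous_def homogeneous_factor)
    have "p \<noteq> 0" using p by auto
    have "x \<noteq> 0"
      using x is_unit_of_homogeneous_deg_0 \<open>p \<noteq> 0\<close> prime_elem_not_unit[OF p(1)] by metis
    have "x \<le> m" "homogeneous_syzygy (m - x) F G H (\<alpha>', \<beta>', \<gamma>')"
      using homogeneous_syzygy_divide_common_factor[OF nz x \<open>p \<noteq> 0\<close> nz'] s eq by auto
    then have "m \<le> m - x"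
      unfolding m_def using min_syzygy_degree_le nz' by blast
    with \<open>x \<noteq> 0\<close> \<open>x \<le> m\<close> show False by linarith
  qed
  ultimately show ?thesis
    using that s(2) unfolding m_def by fastforce
qed

text \<open>
  Both syzygies are orthogonal to \<open>(F, G, H)\<close>, whose entries have no common factor, hence their cross product is \<open>k * (F, G, H)\<close> for some
  polynomial \<open>k\<close>. If \<open>k \<noteq> 0\<close>, comparing degrees gives the first alternative. If \<open>k = 0\<close>, the second
  syzygy is proportional to the primitive first one, hence a multiple of it.
\<close>

lemma syzygy_degree_dichotomy:
  fixes F G H :: "'a::field bpoly"
  assumes nz: "F \<noteq> 0" "G \<noteq> 0" "H \<noteq> 0"
    and hom: "homogeneous_deg a F" "homogeneous_deg b G" "homogeneous_deg c H"
    and free: "common_factor_free F G H"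
    and s: "homogeneous_syzygy d F G H (\<alpha>, \<beta>, \<gamma>)" "common_factor_free \<alpha> \<beta> \<gamma>"
    and s': "homogeneous_syzygy e F G H (\<alpha>', \<beta>', \<gamma>')" "(\<alpha>', \<beta>', \<gamma>') \<noteq> (0, 0, 0)"
  shows "a + b + c \<le> d + e \<or> d \<le> e"
proof -
  define A where "A = \<beta> * \<gamma>' - \<gamma> * \<beta>'"
  define B where "B = \<gamma> * \<alpha>' - \<alpha> * \<gamma>'"
  define C where "C = \<alpha> * \<beta>' - \<beta> * \<alpha>'"
  have syz: "\<alpha> * F + \<beta> * G + \<gamma> * H = 0" "\<alpha>' * F + \<beta>' * G + \<gamma>' * H = 0"
    using s s' by (auto simp: homogeneous_syzygy_def)
  have hs: "homogeneous_deg d (\<alpha> * F)" "homogeneous_deg d (\<beta> * G)" "homogeneous_deg d (\<gamma> * H)"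
    "homogeneous_deg e (\<alpha>' * F)" "homogeneous_deg e (\<beta>' * G)" "homogeneous_deg e (\<gamma>' * H)"
    using s s' by (auto simp: homogeneous_syzygy_def)
  have "A * G - B * F = \<gamma>' * (\<alpha> * F + \<beta> * G + \<gamma> * H) - \<gamma> * (\<alpha>' * F + \<beta>' * G + \<gamma>' * H)"
    "A * H - C * F = \<beta> * (\<alpha>' * F + \<beta>' * G + \<gamma>' * H) - \<beta>' * (\<alpha> * F + \<beta> * G + \<gamma> * H)"
    "B * H - C * G = \<alpha>' * (\<alpha> * F + \<beta> * G + \<gamma> * H) - \<alpha> * (\<alpha>' * F + \<beta>' * G + \<gamma>' * H)"
    unfolding A_def B_def C_def by (simp_all add: algebra_simps)
  then have "A * G = B * F" "A * H = C * F" "B * H = C * G"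
    unfolding syz by simp_all
  moreover have "(F, G, H) \<noteq> (0, 0, 0)" using nz by simp
  ultimately obtain k where k: "A = k * F" "B = k * G" "C = k * H"
    using parallel_imp_multiple[OF free] by metis
  show ?thesis
  proof (cases "k = 0")
    case False
    (* Multiplying by G * H turns the first entry of the cross product into an expression in
       products whose degrees are known. *)
    have "homogeneous_deg (d + e) ((\<beta> * G) * (\<gamma>' * H) - (\<gamma> * H) * (\<beta>' * G))"
      by (intro homogeneous_deg_diff homogeneous_deg_mult hs)
    also have "(\<beta> * G) * (\<gamma>' * H) - (\<gamma> * H) * (\<beta>' * G) = A * (G * H)"
      by (simp add: A_def algebra_simps)
    also have "\<dots> = (F * G * H) * k" by (simp add: k(1))
    finally have "homogeneous_deg (d + e) ((F * G * H) * k)" .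
    moreover have "homogeneous_deg (a + b + c) (F * G * H)"
      by (intro homogeneous_deg_mult hom)
    moreover have "(F * G * H) * k \<noteq> 0" using nz False by simp
    ultimately have "a + b + c \<le> d + e"
      using homogeneous_deg_cancel(2) by blast
    then show ?thesis ..
  next
    case True
    with k have "A = 0" "B = 0" "C = 0" by auto
    then have "\<alpha>' * \<beta> = \<beta>' * \<alpha>" "\<alpha>' * \<gamma> = \<gamma>' * \<alpha>" "\<beta>' * \<gamma> = \<gamma>' * \<beta>"
      by (simp_all add: A_def B_def C_def mult.commute)
    then obtain h where h: "\<alpha>' = h * \<alpha>" "\<beta>' = h * \<beta>" "\<gamma>' = h * \<gamma>"
      using parallel_imp_multiple[OF s(2) common_factor_free_nonzero[OF s(2)]] by metis
    have "h \<noteq> 0" using s'(2) h by auto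
    have le: "d \<le> e" if "homogeneous_deg d P" "homogeneous_deg e (h * P)" "P \<noteq> 0" for P
      using homogeneous_deg_cancel(2)[of e P h d] that \<open>h \<noteq> 0\<close> by (simp add: mult.commute)
    from common_factor_free_nonzero[OF s(2)]
    consider "\<alpha> * F \<noteq> 0" | "\<beta> * G \<noteq> 0" | "\<gamma> * H \<noteq> 0" using nz by auto
    then have "d \<le> e"
      by cases (use hs le in \<open>auto simp: h mult.assoc\<close>)
    then show ?thesis ..
  qed
qed

lemma syzygy_gap_homogeneous_deg:
  assumes "F \<noteq> 0" "G \<noteq> 0" "H \<noteq> 0"
    and "homogeneous_deg a F" "homogeneous_deg b G" "homogeneous_deg c H"
  shows "syzygy_gap F G H = int (a + b + c) - 2 * int (min_syzygy_degree F G H)"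
  using assms by (simp add: syzygy_gap_def total_degree_eq)

lemma syzygy_gap_ge:
  assumes "F \<noteq> 0" "G \<noteq> 0" "H \<noteq> 0"
    and "homogeneous_deg a F" "homogeneous_deg b G" "homogeneous_deg c H"
    and "homogeneous_syzygy d F G H s" "s \<noteq> (0, 0, 0)"
  shows "int (a + b + c) - 2 * int d \<le> syzygy_gap F G H"
  using syzygy_gap_homogeneous_deg[OF assms(1-6)] min_syzygy_degree_le[OF assms(8,7)] by simp

text \<open>
  A syzygy of smaller degree than \<open>d\<close> would, together with the given one, have degrees adding up to
  less than \<open>a + b + c\<close>, so that the dichotomy forbids it.
\<close>

lemma syzygy_gap_eq_primitive:
  fixes F G H :: "'a::field bpoly"
  assumes nz: "F \<noteq> 0" "G \<noteq> 0" "H \<noteq> 0"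
    and hom: "homogeneous_deg a F" "homogeneous_deg b G" "homogeneous_deg c H"
    and free: "common_factor_free F G H"
    and s: "homogeneous_syzygy d F G H (\<alpha>, \<beta>, \<gamma>)" "common_factor_free \<alpha> \<beta> \<gamma>"
    and d: "2 * d \<le> a + b + c"
  shows "syzygy_gap F G H = int (a + b + c) - 2 * int d"
proof -
  let ?m = "min_syzygy_degree F G H"
  obtain \<alpha>' \<beta>' \<gamma>' where s': "homogeneous_syzygy ?m F G H (\<alpha>', \<beta>', \<gamma>')"
    "common_factor_free \<alpha>' \<beta>' \<gamma>'"
    using minimal_syzygy[OF nz hom] by metis
  have "a + b + c \<le> d + ?m \<or> d \<le> ?m"
    using syzygy_degree_dichotomy[OF nz hom free s s'(1) common_factor_free_nonzero[OF s'(2)]] .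
  moreover have "?m \<le> d"
    using min_syzygy_degree_le[OF common_factor_free_nonzero[OF s(2)] s(1)] .
  ultimately have "?m = d" using d by linarith
  then show ?thesis using syzygy_gap_homogeneous_deg[OF nz hom] by simp
qed

section \<open>Transporting a primitive syzygy\<close>

lemma frobenius_add_bpoly:
  fixes P Q :: "'a::field bpoly"
  assumes "CHAR('a) > 0"
  shows "(P + Q) ^ (CHAR('a) ^ k) = P ^ (CHAR('a) ^ k) + Q ^ (CHAR('a) ^ k)"
proof -
  have "prime CHAR('a bpoly)" using prime_CHAR_semidom[where 'a='a, OF assms] by simp
  then show ?thesis by (rule freshmans_dream') simp
qed

text \<open>
  With \<open>U = l^up\<close> and \<open>D = l^down\<close> the triple \<open>(U * \<alpha>^r, U * \<beta>^r, D * \<gamma>^r)\<close> is a syzygy of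
  \<open>(A^r, B^r, C')\<close>, because \<open>D * C' = U * C^r\<close> and raising to the power \<open>r\<close> is additive. It is
  primitive: a prime dividing all three components divides \<open>\<gamma>\<close> or \<open>D\<close>. In neither case does it
  divide both \<open>\<alpha>\<close> and \<open>\<beta>\<close>, so it divides \<open>U\<close> and is associated to some \<open>l i\<close> with \<open>up i > 0\<close>. This
  contradicts \<open>\<not> l i dvd \<gamma>\<close> in the first case, and in the second the coprimality of \<open>l i\<close> with some
  \<open>l j\<close> where \<open>down j > 0\<close>. The hypothesis \<open>small\<close> is the degree bound for primitive syzygies.
\<close>

lemma syzygy_gap_power_shift:
  fixes A B C C' \<alpha> \<beta> \<gamma> :: "'a::field bpoly" and l :: "'n::finite \<Rightarrow> 'a bpoly"
    and up down :: "'n \<Rightarrow> nat"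
  assumes r: "r = CHAR('a) ^ k" "CHAR('a) > 0"
    and nz: "A \<noteq> 0" "B \<noteq> 0" "C \<noteq> 0"
    and hom: "homogeneous_deg a A" "homogeneous_deg b B" "homogeneous_deg c C"
    and s: "homogeneous_syzygy m A B C (\<alpha>, \<beta>, \<gamma>)" "common_factor_free \<alpha> \<beta> \<gamma>"
    and forms: "\<And>i. linear_form (l i)"
    and coprime_forms: "\<And>i j. i \<noteq> j \<Longrightarrow> coprime (l i) (l j)"
    and disjoint: "\<And>i. up i = 0 \<or> down i = 0"
    and up: "\<And>i. up i > 0 \<Longrightarrow> \<not> l i dvd \<gamma>"
    and down: "\<And>i. down i > 0 \<Longrightarrow> \<not> (l i dvd \<alpha> \<and> l i dvd \<beta>)"
    and C': "C' * (\<Prod>i\<in>UNIV. l i ^ down i) = C ^ r * (\<Prod>i\<in>UNIV. l i ^ up i)"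
    and free: "common_factor_free (A ^ r) (B ^ r) C'"
    and small: "r * (2 * m) + (\<Sum>i\<in>UNIV. up i) + (\<Sum>i\<in>UNIV. down i) \<le> r * (a + b + c)"
  shows "syzygy_gap (A ^ r) (B ^ r) C' = int r * (int (a + b + c) - 2 * int m)
           - int (\<Sum>i\<in>UNIV. up i) - int (\<Sum>i\<in>UNIV. down i)"
proof -
  define U where "U = (\<Prod>i\<in>UNIV. l i ^ up i)"
  define D where "D = (\<Prod>i\<in>UNIV. l i ^ down i)"
  define x where "x = (\<Sum>i\<in>UNIV. up i)"
  define y where "y = (\<Sum>i\<in>UNIV. down i)"
  have r0: "r > 0" using r by simp
  have U: "homogeneous_deg x U" "U \<noteq> 0" and D: "homogeneous_deg y D" "D \<noteq> 0"
    unfolding U_def D_def x_def y_def 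
    by (rule homogeneous_deg_prod_linear_forms[OF forms])+
  have CD: "D * C' = C ^ r * U" using C' by (simp add: U_def D_def mult.commute)
  then have DC_nz: "D * C' \<noteq> 0" using nz(3) U by simp
  have DC_hom: "homogeneous_deg (r * c + x) (D * C')"
    unfolding CD by (intro homogeneous_deg_mult homogeneous_deg_power hom U)
  define c' where "c' = r * c + x - y"
  have c': "homogeneous_deg c' C'" "y \<le> r * c + x"
    unfolding c'_def using homogeneous_deg_cancel[OF DC_hom D(1) DC_nz] by auto
  have C'_nz: "C' \<noteq> 0" using DC_nz by auto
  have syz: "\<alpha> * A + \<beta> * B + \<gamma> * C = 0"
    and hs: "homogeneous \<alpha>" "homogeneous \<beta>" "homogeneous \<gamma>"
      "homogeneous_deg m (\<alpha> * A)" "homogeneous_deg m (\<beta> * B)" "homogeneous_deg m (\<gamma> * C)"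
    using s(1) unfolding homogeneous_syzygy_def prod.case by blast+
  have prods: "U * \<alpha> ^ r * A ^ r = U * (\<alpha> * A) ^ r" "U * \<beta> ^ r * B ^ r = U * (\<beta> * B) ^ r"
    "D * \<gamma> ^ r * C' = U * (\<gamma> * C) ^ r"
    using CD by (simp_all add: power_mult_distrib mult.assoc mult.left_commute)
  have hom_prod: "homogeneous_deg (x + r * m) (U * P ^ r)" if "homogeneous_deg m P" for P
    by (intro homogeneous_deg_mult homogeneous_deg_power U that)
  have hom_comp: "homogeneous (V * P ^ r)" if "homogeneous P" "homogeneous_deg z V" for V P z
    using that homogeneous_deg_mult[OF that(2)] homogeneous_deg_power unfolding homogeneous_def by blast
  have "homogeneous_syzygy (x + r * m) (A ^ r) (B ^ r) C' (U * \<alpha> ^ r, U * \<beta> ^ r, D * \<gamma> ^ r)"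
    unfolding homogeneous_syzygy_def prod.case
  proof (intro conjI)
    have "U * \<alpha> ^ r * A ^ r + U * \<beta> ^ r * B ^ r + D * \<gamma> ^ r * C'
        = U * ((\<alpha> * A) ^ r + (\<beta> * B) ^ r + (\<gamma> * C) ^ r)"
      unfolding prods by (simp add: distrib_left)
    also have "(\<alpha> * A) ^ r + (\<beta> * B) ^ r + (\<gamma> * C) ^ r = (\<alpha> * A + \<beta> * B + \<gamma> * C) ^ r"
      unfolding r(1) using frobenius_add_bpoly[OF r(2)] by metis
    also have "\<dots> = 0" using syz r0 by simp
    finally show "U * \<alpha> ^ r * A ^ r + U * \<beta> ^ r * B ^ r + D * \<gamma> ^ r * C' = 0" by simp
  qed (unfold prods, (intro hom_comp[OF _ U(1)] hom_comp[OF _ D(1)] hom_prod hs)+)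
  moreover have "common_factor_free (U * \<alpha> ^ r) (U * \<beta> ^ r) (D * \<gamma> ^ r)"
  proof (rule common_factor_freeI_prime)
    show "(U * \<alpha> ^ r, U * \<beta> ^ r, D * \<gamma> ^ r) \<noteq> (0, 0, 0)"
      using common_factor_free_nonzero[OF s(2)] U(2) D(2) by auto
    fix P assume P: "prime_elem P"
      and dvd: "P dvd U * \<alpha> ^ r" "P dvd U * \<beta> ^ r" "P dvd D * \<gamma> ^ r"
    have form_dvd: "l i dvd P" if "P dvd l i" for i
      using prime_elem_dvd_imp_dvd[OF P prime_elem_linear_form[OF forms] that] .
    have split: "P dvd V \<or> P dvd Q" if "P dvd V * Q ^ r" for V Q
      using that prime_elem_dvd_multD[OF P] prime_elem_dvd_power[OF P] by blast
    have dvd_U: "P dvd U" if "\<not> (P dvd \<alpha> \<and> P dvd \<beta>)"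
      using that split[OF dvd(1)] split[OF dvd(2)] by blast
    from split[OF dvd(3)] show False
    proof
      assume "P dvd \<gamma>"
      then have "P dvd U"
        using dvd_U common_factor_freeD_prime[OF s(2) P] by blast
      then obtain i where "up i > 0" "P dvd l i"
        unfolding U_def by (rule prime_elem_dvd_prod_power[OF P])
      then show False
        using form_dvd up \<open>P dvd \<gamma>\<close> dvd_trans by blast
    next
      assume "P dvd D"
      then obtain j where j: "down j > 0" "P dvd l j"
        unfolding D_def by (rule prime_elem_dvd_prod_power[OF P])
      then have "P dvd U"
        using dvd_U form_dvd[OF j(2)] down[OF j(1)] dvd_trans by blast
      then obtain i where i: "up i > 0" "P dvd l i"
        unfolding U_def by (rule prime_elem_dvd_prod_power[OF P])
      then have "i \<noteq> j" using j(1) disjoint[of j] by auto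
      then have "P dvd 1" using coprime_forms i(2) j(2) coprime_common_divisor by blast
      then show False using prime_elem_not_unit[OF P] by blast
    qed
  qed
  moreover have "2 * (x + r * m) \<le> r * a + r * b + c'"
    using small c'(2) unfolding x_def[symmetric] y_def[symmetric] c'_def
    by (simp add: algebra_simps)
  ultimately have "syzygy_gap (A ^ r) (B ^ r) C' = int (r * a + r * b + c') - 2 * int (x + r * m)"
    using nz C'_nz homogeneous_deg_power hom c'(1) free
    by (intro syzygy_gap_eq_primitive) auto
  then show ?thesis
    using c'(2) unfolding x_def[symmetric] y_def[symmetric] c'_def
    by (simp add: algebra_simps of_nat_diff)
qed

text \<open>
  The special case \<open>up = down = 0\<close> of the transport of a primitive syzygy.
\<close>

lemma syzygy_gap_frobenius:
  fixes A B C :: "'a::field bpoly"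
  assumes r: "r = CHAR('a) ^ k" "CHAR('a) > 0"
    and nz: "A \<noteq> 0" "B \<noteq> 0" "C \<noteq> 0"
    and hom: "homogeneous A" "homogeneous B" "homogeneous C"
    and free: "common_factor_free A B C"
  shows "syzygy_gap (A ^ r) (B ^ r) (C ^ r) = int r * syzygy_gap A B C"
proof -
  obtain a b c where deg: "homogeneous_deg a A" "homogeneous_deg b B" "homogeneous_deg c C"
    using hom by (auto simp: homogeneous_def)
  define m where "m = min_syzygy_degree A B C"
  obtain \<alpha> \<beta> \<gamma> where s: "homogeneous_syzygy m A B C (\<alpha>, \<beta>, \<gamma>)"
    "common_factor_free \<alpha> \<beta> \<gamma>" "2 * m \<le> a + b + c"
    using minimal_syzygy[OF nz deg] unfolding m_def by metis
  have "common_factor_free (A ^ r) (B ^ r) (C ^ r)"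
    by (rule common_factor_free_same_primes[OF free]) (use nz in \<open>simp_all add: prime_elem_dvd_power\<close>)
  moreover have "r * (2 * m) \<le> r * (a + b + c)" using s(3) by (rule mult_le_mono2)
  ultimately have "syzygy_gap (A ^ r) (B ^ r) (C ^ r) = int r * (int (a + b + c) - 2 * int m)"
    (* All exponents are 0, over the family consisting of the single linear form y. *)
    using syzygy_gap_power_shift[OF r nz deg s(1,2), of "\<lambda>_ :: unit. monom 1 1" "\<lambda>_. 0" "\<lambda>_. 0" "C ^ r"]
    by (auto simp: linear_form_def homogeneous_deg_iff monom_eq_0_iff split: if_splits)
  then show ?thesis
    using syzygy_gap_homogeneous_deg[OF nz deg] by (simp add: m_def)
qed

text \<open>
  The syzygy \<open>(\<alpha>, \<beta>, \<gamma> / L)\<close> of \<open>(A, B, C * L)\<close> has the same degree \<open>m\<close>, while the sum of the degrees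
  of the polynomials has grown by \<open>1\<close>.
\<close>

lemma syzygy_gap_mult_form_ge:
  fixes A B C L :: "'a::field bpoly"
  assumes nz: "A \<noteq> 0" "B \<noteq> 0" "C \<noteq> 0"
    and hom: "homogeneous_deg a A" "homogeneous_deg b B" "homogeneous_deg c C"
    and s: "homogeneous_syzygy m A B C (\<alpha>, \<beta>, \<gamma>)" "(\<alpha>, \<beta>, \<gamma>) \<noteq> (0, 0, 0)"
    and L: "linear_form L" "L dvd \<gamma>"
  shows "int (a + b + c) + 1 - 2 * int m \<le> syzygy_gap A B (C * L)"
proof -
  obtain \<gamma>' where \<gamma>: "\<gamma> = \<gamma>' * L" using L(2) by (metis dvdE mult.commute)
  have L': "L \<noteq> 0" "homogeneous_deg 1 L" using L(1) by (auto simp: linear_form_def)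
  have syz: "\<alpha> * A + \<beta> * B + \<gamma> * C = 0"
    and hs: "homogeneous \<alpha>" "homogeneous \<beta>" "homogeneous \<gamma>"
      "homogeneous_deg m (\<alpha> * A)" "homogeneous_deg m (\<beta> * B)" "homogeneous_deg m (\<gamma> * C)"
    using s(1) unfolding homogeneous_syzygy_def prod.case by blast+
  have eq: "\<gamma>' * (C * L) = \<gamma> * C" by (simp add: \<gamma> ac_simps)
  have "homogeneous \<gamma>'"
  proof (cases "\<gamma> = 0")
    case True
    then have "\<gamma>' = 0" using L' \<gamma> by simp
    then show ?thesis by (simp add: homogeneous_def)
  next
    case False
    then show ?thesis using hs(3) homogeneous_factor unfolding homogeneous_def \<gamma> by metis
  qed
  with syz hs have "homogeneous_syzygy m A B (C * L) (\<alpha>, \<beta>, \<gamma>')"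
    unfolding homogeneous_syzygy_def prod.case eq by blast
  moreover have "(\<alpha>, \<beta>, \<gamma>') \<noteq> (0, 0, 0)" using s(2) \<gamma> by auto
  ultimately have "int (a + b + (c + 1)) - 2 * int m \<le> syzygy_gap A B (C * L)"
    using nz L' hom by (intro syzygy_gap_ge homogeneous_deg_mult) auto
  then show ?thesis by simp
qed

text \<open>
  The syzygy \<open>(\<alpha> / L, \<beta> / L, \<gamma>)\<close> of \<open>(A, B, C)\<close> has degree \<open>m - 1\<close>, while the sum of the degrees of the
  polynomials has only dropped by \<open>1\<close>.
\<close>

lemma syzygy_gap_divide_form_ge:
  fixes A B C L :: "'a::field bpoly"
  assumes nz: "A \<noteq> 0" "B \<noteq> 0" "C \<noteq> 0"
    and hom: "homogeneous_deg a A" "homogeneous_deg b B" "homogeneous_deg c C"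
    and s: "homogeneous_syzygy m A B (C * L) (\<alpha>, \<beta>, \<gamma>)" "(\<alpha>, \<beta>, \<gamma>) \<noteq> (0, 0, 0)"
    and L: "linear_form L" "L dvd \<alpha>" "L dvd \<beta>"
  shows "int (a + b + c) + 2 - 2 * int m \<le> syzygy_gap A B C"
proof -
  obtain \<alpha>' \<beta>' where eq: "\<alpha> = L * \<alpha>'" "\<beta> = L * \<beta>'" using L(2,3) by (metis dvdE)
  have L': "L \<noteq> 0" "homogeneous_deg 1 L" using L(1) by (auto simp: linear_form_def)
  have syz: "\<alpha> * A + \<beta> * B + \<gamma> * (C * L) = 0"
    and hs: "homogeneous \<alpha>" "homogeneous \<beta>" "homogeneous \<gamma>" "homogeneous_deg m (\<alpha> * A)"
      "homogeneous_deg m (\<beta> * B)" "homogeneous_deg m (\<gamma> * (C * L))"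
    using s(1) unfolding homogeneous_syzygy_def prod.case by blast+
  have eq': "L * \<gamma> * C = \<gamma> * (C * L)" by (simp add: ac_simps)
  have hL: "homogeneous (L * \<gamma>)"
    using hs(3) homogeneous_deg_mult[OF L'(2)] unfolding homogeneous_def by blast
  (* L times the desired syzygy is the given one, so L can be cancelled. *)
  have "homogeneous_syzygy m A B C (L * \<alpha>', L * \<beta>', L * \<gamma>)"
    using syz hs hL unfolding homogeneous_syzygy_def prod.case eq' eq[symmetric] by blast
  moreover have nz': "(\<alpha>', \<beta>', \<gamma>) \<noteq> (0, 0, 0)" using s(2) eq by auto
  ultimately have "1 \<le> m" "homogeneous_syzygy (m - 1) A B C (\<alpha>', \<beta>', \<gamma>)"
    using homogeneous_syzygy_divide_common_factor[OF nz L'(2,1) nz'] by blast+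
  then show ?thesis
    using syzygy_gap_ge[OF nz hom _ nz', of "m - 1"] by simp
qed

section \<open>The function attached to a cell\<close>

text \<open>
  \<open>q\<close> times the value of \<open>\<delta>\<close> at \<open>a / q\<close>; an integer depending on the denominator \<open>q\<close>.
\<close>

definition level_gap ::
  "('n::finite \<Rightarrow> 'a::field bpoly) \<Rightarrow> 'a bpoly \<Rightarrow> 'a bpoly \<Rightarrow> 'a bpoly \<Rightarrow> nat \<Rightarrow> ('n \<Rightarrow> nat) \<Rightarrow> int"
where
  "level_gap l F G H q a = syzygy_gap (F ^ q) (G ^ q) (H ^ q * (\<Prod>i\<in>UNIV. l i ^ a i))"

lemma cell_common_factor_free:
  fixes l :: "'n::finite \<Rightarrow> 'a::field bpoly"
  assumes cell: "cell l F G H"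
  shows "common_factor_free (F ^ q) (G ^ q) (H ^ q * (\<Prod>i\<in>UNIV. l i ^ a i))"
proof -
  have free: "common_factor_free F G (H * (\<Prod>i\<in>UNIV. l i))" and "F \<noteq> 0"
    using cell unfolding cell_def common_factor_free_def by blast+
  show ?thesis
  proof (rule common_factor_free_same_primes[OF free])
    show "F ^ q \<noteq> 0" using \<open>F \<noteq> 0\<close> by simp
    fix P :: "'a bpoly" assume P: "prime_elem P"
    show "P dvd F ^ q \<Longrightarrow> P dvd F" "P dvd G ^ q \<Longrightarrow> P dvd G"
      using prime_elem_dvd_power[OF P] by blast+
    assume "P dvd H ^ q * (\<Prod>i\<in>UNIV. l i ^ a i)"
    then consider "P dvd H" | "P dvd (\<Prod>i\<in>UNIV. l i ^ a i)"
      using prime_elem_dvd_multD[OF P] prime_elem_dvd_power[OF P] by blast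
    then show "P dvd H * (\<Prod>i\<in>UNIV. l i)"
    proof cases
      case 2
      then obtain i where "P dvd l i" by (rule prime_elem_dvd_prod_power[OF P])
      moreover have "l i dvd (\<Prod>i\<in>UNIV. l i)" by (rule dvd_prodI) auto
      ultimately show ?thesis using dvd_trans dvd_mult by blast
    qed simp
  qed
qed

lemma cell_homogeneous:
  fixes l :: "'n::finite \<Rightarrow> 'a::field bpoly"
  assumes cell: "cell l F G H" and forms: "\<And>i. linear_form (l i)"
  shows "F ^ q \<noteq> 0" "G ^ q \<noteq> 0" "H ^ q * (\<Prod>i\<in>UNIV. l i ^ a i) \<noteq> 0"
    "homogeneous (F ^ q)" "homogeneous (G ^ q)" "homogeneous (H ^ q * (\<Prod>i\<in>UNIV. l i ^ a i))"
proof -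
  have nz: "F \<noteq> 0" "G \<noteq> 0" "H \<noteq> 0" and hom: "homogeneous F" "homogeneous G" "homogeneous H"
    using cell unfolding cell_def by blast+
  show "F ^ q \<noteq> 0" "G ^ q \<noteq> 0" "H ^ q * (\<Prod>i\<in>UNIV. l i ^ a i) \<noteq> 0"
    using nz homogeneous_deg_prod_linear_forms(2)[of l a, OF forms] by simp_all
  show "homogeneous (F ^ q)" "homogeneous (G ^ q)"
    using hom homogeneous_deg_power unfolding homogeneous_def by blast+
  show "homogeneous (H ^ q * (\<Prod>i\<in>UNIV. l i ^ a i))"
    using hom(3) homogeneous_deg_power[of _ H q] homogeneous_deg_prod_linear_forms(1)[of l a, OF forms]
      homogeneous_deg_mult unfolding homogeneous_def by blast
qed

lemma level_gap_nonneg: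
  fixes l :: "'n::finite \<Rightarrow> 'a::field bpoly"
  assumes cell: "cell l F G H" and forms: "\<And>i. linear_form (l i)"
  shows "0 \<le> level_gap l F G H q a"
proof -
  note ch = cell_homogeneous[OF cell forms]
  obtain x y z where deg: "homogeneous_deg x (F ^ q)" "homogeneous_deg y (G ^ q)"
    "homogeneous_deg z (H ^ q * (\<Prod>i\<in>UNIV. l i ^ a i))"
    using ch(4-6) unfolding homogeneous_def by metis
  show ?thesis
    unfolding level_gap_def syzygy_gap_homogeneous_deg[OF ch(1-3) deg]
    by (rule minimal_syzygy[OF ch(1-3) deg]) linarith
qed

lemma level_gap_frobenius:
  fixes l :: "'n::finite \<Rightarrow> 'a::field bpoly"
  assumes cell: "cell l F G H" and forms: "\<And>i. linear_form (l i)"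
    and r: "r = CHAR('a) ^ k" "CHAR('a) > 0"
  shows "level_gap l F G H (q * r) (\<lambda>i. a i * r) = int r * level_gap l F G H q a"
proof -
  have "H ^ (q * r) * (\<Prod>i\<in>UNIV. l i ^ (a i * r)) = (H ^ q * (\<Prod>i\<in>UNIV. l i ^ a i)) ^ r"
    by (simp add: power_mult power_mult_distrib prod_power_distrib)
  then show ?thesis
    unfolding level_gap_def power_mult
    using syzygy_gap_frobenius[OF r cell_homogeneous[OF cell forms] cell_common_factor_free[OF cell]]
    by (simp add: power_mult)
qed

text \<open>
  Of two denominators that are powers of the characteristic, the larger one is the smaller one times
  a power of the characteristic; both quotients then agree because gaps scale by that power.
\<close>

lemma cell_gap_eq:
  fixes l :: "'n::finite \<Rightarrow> 'a::field bpoly" and t :: "real ^ 'n"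
  assumes cell: "cell l F G H" and forms: "\<And>i. linear_form (l i)"
    and char: "CHAR('a) > 0" and q: "q = CHAR('a) ^ e"
    and a: "\<And>i. a i \<le> q" "\<And>i. t $ i = real (a i) / real q"
  shows "cell_gap l F G H t = real_of_int (level_gap l F G H q a) / real q"
proof -
  have eq: "real_of_int (level_gap l F G H q a) / real q = real_of_int (level_gap l F G H q' a') / real q'"
    if "q = CHAR('a) ^ e" "q' = CHAR('a) ^ e'" "e \<le> e'"
      "\<And>i. t $ i = real (a i) / real q" "\<And>i. t $ i = real (a' i) / real q'"
    for q q' e e' and a a' :: "'n \<Rightarrow> nat"
  proof -
    define r where "r = CHAR('a) ^ (e' - e)"
    have pos: "q > 0" "r > 0" using char that(1) by (auto simp: r_def)
    have q': "q' = q * r" using that(1-3) by (simp add: r_def flip: power_add)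
    have "a' i = a i * r" for i
    proof -
      have "real (a' i) = real (a i * r)"
        using that(4)[of i] that(5)[of i] pos by (simp add: q' field_simps)
      then show ?thesis by linarith
    qed
    then have "a' = (\<lambda>i. a i * r)" by auto
    then have "level_gap l F G H q' a' = int r * level_gap l F G H q a"
      using level_gap_frobenius[OF cell forms r_def char] q' by simp
    then show ?thesis using pos by (simp add: q')
  qed
  have "cell_gap l F G H t = (THE v. \<forall>e q. \<forall>a :: 'n \<Rightarrow> nat.
     q = CHAR('a) ^ e \<and> (\<forall>i. a i \<le> q \<and> t $ i = real (a i) / real q) \<longrightarrow>
     v = real_of_int (level_gap l F G H q a) / real q)"
    by (simp add: cell_gap_def level_gap_def)
  also have "\<dots> = real_of_int (level_gap l F G H q a) / real q"
  proof (rule the_equality)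
    show "\<forall>e' q'. \<forall>a' :: 'n \<Rightarrow> nat.
       q' = CHAR('a) ^ e' \<and> (\<forall>i. a' i \<le> q' \<and> t $ i = real (a' i) / real q') \<longrightarrow>
       real_of_int (level_gap l F G H q a) / real q = real_of_int (level_gap l F G H q' a') / real q'"
    proof (intro allI impI, elim conjE)
      fix e' q' and a' :: "'n \<Rightarrow> nat"
      assume *: "q' = CHAR('a) ^ e'" "\<forall>i. a' i \<le> q' \<and> t $ i = real (a' i) / real q'"
      show "real_of_int (level_gap l F G H q a) / real q = real_of_int (level_gap l F G H q' a') / real q'"
      proof (cases "e \<le> e'")
        case True
        then show ?thesis by (rule eq[OF q *(1)]) (use a *(2) in auto)
      next
        case False
        then have "e' \<le> e" by simp
        then show ?thesis by (intro eq[OF *(1) q, symmetric]) (use a *(2) in auto)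
      qed
    qed
  qed (use q a in blast)
  finally show ?thesis .
qed

text \<open>
  A common denominator for the coordinates, which may be taken larger than any prescribed power
  \<open>p^e\<close>.
\<close>

lemma p_cube_denominator:
  fixes t :: "real ^ 'n::finite"
  assumes t: "t \<in> p_cube p" and p: "p > 0"
  obtains k b where "k \<ge> e" "\<And>i. b i \<le> p ^ k" "\<And>i. t $ i = real (b i) / real (p ^ k)"
proof -
  have "\<exists>n m. t $ i = of_int m / real p ^ n \<and> 0 \<le> t $ i \<and> t $ i \<le> 1" for i
    using t unfolding p_cube_def p_unit_interval_def by fastforce
  then obtain n m where nm: "\<And>i. t $ i = of_int (m i) / real p ^ n i" "\<And>i. 0 \<le> t $ i" "\<And>i. t $ i \<le> 1"
    by metis
  define k where "k = e + (\<Sum>i\<in>UNIV. n i)"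
  define b where "b = (\<lambda>i. nat (m i) * p ^ (k - n i))"
  have le: "n i \<le> k" for i
    unfolding k_def by (intro trans_le_add2 member_le_sum) auto
  have b: "t $ i = real (b i) / real (p ^ k)" for i
  proof -
    have "real p ^ n i > 0" using p by simp
    from nm(2)[of i] have "m i \<ge> 0"
      unfolding nm(1)[of i] pos_le_divide_eq[OF \<open>real p ^ n i > 0\<close>] by simp
    moreover have "real p ^ k = real p ^ n i * real p ^ (k - n i)"
      using le[of i] by (simp flip: power_add)
    ultimately show ?thesis using p by (simp add: b_def nm(1))
  qed
  have "b i \<le> p ^ k" for i
  proof -
    have "real (b i) \<le> real (p ^ k)"
      using nm(3)[of i] p unfolding b[of i] by (simp add: divide_le_eq)
    then show ?thesis by (simp only: of_nat_le_iff)
  qed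
  then show ?thesis using that[of k b] b by (simp add: k_def)
qed

section \<open>Local maxima\<close>

text \<open>
  The closed orthants at \<open>u\<close> are polyhedra on which every \<open>\<bar>x $ i - u $ i\<bar>\<close> is affine.
\<close>

lemma piecewise_linear_on_minus_taxicab:
  fixes f :: "real ^ 'n::finite \<Rightarrow> real"
  assumes "\<And>x. x \<in> S \<Longrightarrow> f x = M - taxicab x u"
  shows "piecewise_linear_on S f"
proof -
  define half where "half = (\<lambda>(A :: 'n set) i. if i \<in> A then {x :: real ^ 'n. axis i 1 \<bullet> x \<ge> u $ i}
    else {x. axis i 1 \<bullet> x \<le> u $ i})"
  define orthant where "orthant = (\<lambda>A. \<Inter> (range (half A)))"
  define sg where "sg = (\<lambda>(A :: 'n set) i. if i \<in> A then 1 else - 1 :: real)"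
  have mem: "x \<in> orthant A \<longleftrightarrow> (\<forall>i. if i \<in> A then x $ i \<ge> u $ i else x $ i \<le> u $ i)" for x A
    by (auto simp: orthant_def half_def inner_axis' split: if_splits)
  have "polyhedron (orthant A)" for A
    unfolding orthant_def half_def
    by (intro polyhedron_Inter) (auto simp: polyhedron_halfspace_ge polyhedron_halfspace_le)
  moreover have "x \<in> orthant {i. x $ i \<ge> u $ i}" for x
    by (auto simp: mem)
  then have "S \<subseteq> \<Union> (range orthant)" by blast
  moreover have "\<exists>a b. \<forall>x\<in>orthant A. M - taxicab x u = a \<bullet> x + b" for A
  proof (intro exI ballI)
    fix x assume "x \<in> orthant A"
    then have "\<bar>x $ i - u $ i\<bar> = sg A i * (x $ i - u $ i)" for i
      by (auto simp: mem sg_def abs_if split: if_splits) (smt (verit))+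
    then have "taxicab x u = (\<Sum>i\<in>UNIV. sg A i * (x $ i - u $ i))"
      by (simp add: taxicab_def)
    then show "M - taxicab x u = (\<chi> i. - sg A i) \<bullet> x + (M + (\<Sum>i\<in>UNIV. sg A i * u $ i))"
      by (simp add: inner_vec_def right_diff_distrib sum_subtractf sum_negf)
  qed
  ultimately show ?thesis
    unfolding piecewise_linear_on_def
    by (intro exI[of _ "range orthant"] exI[of _ "\<lambda>x. M - taxicab x u"]) (auto simp: assms)
qed

lemma grid_neighbour_level_gap_less:
  fixes l :: "'n::finite \<Rightarrow> 'a::field bpoly" and u :: "real ^ 'n"
  assumes cell: "cell l F G H" and forms: "\<And>i. linear_form (l i)"
    and char: "CHAR('a) > 0" and q: "q = CHAR('a) ^ e"
    and local_max: "\<And>t. t \<in> grid q \<Longrightarrow> adjacent q t u \<Longrightarrow> cell_gap l F G H t < cell_gap l F G H u"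
    and a: "\<And>i. a i \<le> q" "\<And>i. u $ i = real (a i) / real q"
    and a': "\<And>j. a' j \<le> q" "\<And>j. j \<noteq> i \<Longrightarrow> a' j = a j" "a' i = a i + 1 \<or> a i = a' i + 1"
  shows "level_gap l F G H q a' < level_gap l F G H q a"
proof -
  define t :: "real ^ 'n" where "t = (\<chi> j. real (a' j) / real q)"
  have q0: "real q > 0" using q char by simp
  have t: "t $ j = real (a' j) / real q" for j by (simp add: t_def)
  have "t \<in> grid q" using a' unfolding grid_def by (auto simp: t)
  moreover have "\<bar>t $ i - u $ i\<bar> = 1 / real q"
    using a'(3) q0 by (auto simp: t a simp flip: diff_divide_distrib)
  then have "adjacent q t u"
    using a'(2) unfolding adjacent_def by (intro exI[of _ i]) (auto simp: t a)
  ultimately have "cell_gap l F G H t < cell_gap l F G H u" by (rule local_max)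
  then have "real_of_int (level_gap l F G H q a') / real q < real_of_int (level_gap l F G H q a) / real q"
    using cell_gap_eq[OF cell forms char q a'(1) t] cell_gap_eq[OF cell forms char q a] by simp
  then show ?thesis using q0 by (simp add: divide_less_cancel)
qed

text \<open>
  Every point of the grid has a neighbour, and the value there is nonnegative.
\<close>

lemma cell_gap_pos_at_local_max:
  fixes l :: "'n::finite \<Rightarrow> 'a::field bpoly" and u :: "real ^ 'n"
  assumes cell: "cell l F G H" and forms: "\<And>i. linear_form (l i)"
    and char: "CHAR('a) > 0" and q: "q = CHAR('a) ^ e" and u: "u \<in> grid q"
    and local_max: "\<And>t. t \<in> grid q \<Longrightarrow> adjacent q t u \<Longrightarrow> cell_gap l F G H t < cell_gap l F G H u"
  shows "0 < cell_gap l F G H u"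
proof -
  from u obtain a where a: "\<And>i. a i \<le> q" "\<And>i. u $ i = real (a i) / real q"
    unfolding grid_def by (simp; metis)
  have q0: "q > 0" using q char by simp
  obtain i :: 'n where True by simp
  define a' where "a' = a(i := if a i < q then a i + 1 else a i - 1)"
  have "level_gap l F G H q a' < level_gap l F G H q a"
    by (rule grid_neighbour_level_gap_less[OF cell forms char q local_max a, of _ i])
       (use a(1) q0 in \<open>auto simp: a'_def intro: le_trans[OF diff_le_self]\<close>)
  moreover have "0 \<le> level_gap l F G H q a'" by (rule level_gap_nonneg[OF cell forms])
  ultimately have "0 < level_gap l F G H q a" by linarith
  then show ?thesis
    using cell_gap_eq[OF cell forms char q a] q0 by simp
qed

text \<open>
  A syzygy \<open>(\<alpha>, \<beta>, \<gamma>)\<close> of least degree at \<open>u\<close> satisfies the divisibility conditions that allow it to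
  be transported to \<open>t\<close>: a failure would make the gap grow at a neighbour of \<open>u\<close>.
\<close>

lemma cell_gap_eq_minus_taxicab:
  fixes l :: "'n::finite \<Rightarrow> 'a::field bpoly" and t u :: "real ^ 'n"
  assumes cell: "cell l F G H" and forms: "\<And>i. linear_form (l i)"
    and coprime_forms: "\<And>i j. i \<noteq> j \<Longrightarrow> coprime (l i) (l j)"
    and char: "CHAR('a) > 0" and q: "q = CHAR('a) ^ e" and u: "u \<in> grid q"
    and local_max: "\<And>t. t \<in> grid q \<Longrightarrow> adjacent q t u \<Longrightarrow> cell_gap l F G H t < cell_gap l F G H u"
    and t: "t \<in> p_cube CHAR('a)" and near: "taxicab t u \<le> cell_gap l F G H u"
  shows "cell_gap l F G H t = cell_gap l F G H u - taxicab t u"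
proof -
  from u obtain a where a: "\<And>i. a i \<le> q" "\<And>i. u $ i = real (a i) / real q"
    unfolding grid_def by (simp; metis)
  define A where "A = F ^ q"
  define B where "B = G ^ q"
  define C where "C = H ^ q * (\<Prod>i\<in>UNIV. l i ^ a i)"
  have nz: "A \<noteq> 0" "B \<noteq> 0" "C \<noteq> 0" and hom: "homogeneous A" "homogeneous B" "homogeneous C"
    unfolding A_def B_def C_def using cell_homogeneous[OF cell forms] by blast+
  obtain x y z where deg: "homogeneous_deg x A" "homogeneous_deg y B" "homogeneous_deg z C"
    using hom unfolding homogeneous_def by metis
  define m where "m = min_syzygy_degree A B C"
  obtain \<alpha> \<beta> \<gamma> where s: "homogeneous_syzygy m A B C (\<alpha>, \<beta>, \<gamma>)"
    "common_factor_free \<alpha> \<beta> \<gamma>" "2 * m \<le> x + y + z"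
    using minimal_syzygy[OF nz deg] unfolding m_def by metis
  note s_nz = common_factor_free_nonzero[OF s(2)]
  have gap_u: "level_gap l F G H q a = int (x + y + z) - 2 * int m"
    using syzygy_gap_homogeneous_deg[OF nz deg] by (simp add: level_gap_def A_def B_def C_def m_def)
  note less = grid_neighbour_level_gap_less[OF cell forms char q local_max a]

  have up_cond: "\<not> l i dvd \<gamma>" if "a i < q" for i
  proof
    assume "l i dvd \<gamma>"
    define a' where "a' = a(i := a i + 1)"
    have "(\<Prod>i\<in>UNIV. l i ^ a' i) = (\<Prod>i\<in>UNIV. l i ^ a i) * l i"
      by (simp add: a'_def prod.remove[of UNIV i] ac_simps)
    then have "level_gap l F G H q a' = syzygy_gap A B (C * l i)"
      by (simp add: level_gap_def A_def B_def C_def mult.assoc)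
    moreover have "level_gap l F G H q a' < level_gap l F G H q a"
      by (rule less[of _ i]) (use a(1) that in \<open>auto simp: a'_def Suc_le_eq\<close>)
    ultimately show False
      using syzygy_gap_mult_form_ge[OF nz deg s(1) s_nz forms \<open>l i dvd \<gamma>\<close>] gap_u by simp
  qed

  have down_cond: "\<not> (l i dvd \<alpha> \<and> l i dvd \<beta>)" if "a i > 0" for i
  proof
    assume dvd: "l i dvd \<alpha> \<and> l i dvd \<beta>"
    define a' where "a' = a(i := a i - 1)"
    define C0 where "C0 = H ^ q * (\<Prod>i\<in>UNIV. l i ^ a' i)"
    have "l i ^ a i = l i ^ (a i - 1) * l i" using that by (cases "a i") auto
    then have "(\<Prod>i\<in>UNIV. l i ^ a i) = (\<Prod>i\<in>UNIV. l i ^ a' i) * l i"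
      by (simp add: a'_def prod.remove[of UNIV i] ac_simps)
    then have C: "C = C0 * l i" by (simp add: C_def C0_def mult.assoc)
    have C0: "C0 \<noteq> 0" using nz C by auto
    have li: "homogeneous_deg 1 (l i)" using forms by (simp add: linear_form_def)
    have "homogeneous_deg z (l i * C0)" "l i * C0 \<noteq> 0" using deg(3) nz C by (simp_all add: mult.commute)
    then have z: "homogeneous_deg (z - 1) C0" "1 \<le> z"
      using homogeneous_deg_cancel[of z "l i" C0 1] li by blast+
    have "level_gap l F G H q a' < level_gap l F G H q a"
      by (rule less[of _ i]) (use a(1) that in \<open>auto simp: a'_def intro: le_trans[OF diff_le_self]\<close>)
    moreover have "level_gap l F G H q a' = syzygy_gap A B C0"
      by (simp add: level_gap_def A_def B_def C0_def)
    moreover have "int (x + y + (z - 1)) + 2 - 2 * int m \<le> syzygy_gap A B C0"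
      using syzygy_gap_divide_form_ge[OF nz(1,2) C0 deg(1,2) z(1) _ s_nz forms[of i]] s(1) dvd
      unfolding C by blast
    ultimately show False using gap_u z(2) by simp
  qed

  obtain k b where kb: "k \<ge> e" "\<And>i. b i \<le> CHAR('a) ^ k" "\<And>i. t $ i = real (b i) / real (CHAR('a) ^ k)"
    using p_cube_denominator[OF t char, of e] by metis
  define r where "r = CHAR('a) ^ (k - e)"
  have qr: "CHAR('a) ^ k = q * r" using kb(1) by (simp add: q r_def flip: power_add)
  have pos: "q > 0" "r > 0" using q char by (auto simp: r_def)
  define up where "up = (\<lambda>i. b i - a i * r)"
  define down where "down = (\<lambda>i. a i * r - b i)"
  define D where "D = (\<Sum>i\<in>UNIV. up i) + (\<Sum>i\<in>UNIV. down i)"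
  have bal: "b i + down i = a i * r + up i" for i by (simp add: up_def down_def)
  have disjoint: "up i = 0 \<or> down i = 0" for i
    by (cases "b i \<le> a i * r") (simp_all add: up_def down_def)
  have dist: "taxicab t u = real D / (real q * real r)"
  proof -
    have "\<bar>t $ i - u $ i\<bar> = (real (up i) + real (down i)) / (real q * real r)" for i
    proof -
      have "t $ i - u $ i = (real (b i) - real (a i * r)) / (real q * real r)"
        using pos by (simp add: kb(3) a(2) qr field_simps)
      also have "real (b i) - real (a i * r) = real (up i) - real (down i)"
        using bal[of i] by (simp flip: of_nat_add of_nat_mult add: algebra_simps)
      finally have "\<bar>t $ i - u $ i\<bar> = \<bar>real (up i) - real (down i)\<bar> / (real q * real r)"
        by (simp add: abs_mult)
      also have "\<bar>real (up i) - real (down i)\<bar> = real (up i) + real (down i)"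
        using disjoint[of i] by auto
      finally show ?thesis .
    qed
    then show ?thesis
      by (simp add: taxicab_def D_def sum.distrib flip: sum_divide_distrib)
  qed
  have val_u: "cell_gap l F G H u = (real (x + y + z) - 2 * real m) / real q"
    using cell_gap_eq[OF cell forms char q a] gap_u by simp
  have "real D \<le> real r * (real (x + y + z) - 2 * real m)"
    using near pos unfolding dist val_u by (simp add: field_simps)
  then have "real (r * (2 * m) + D) \<le> real (r * (x + y + z))"
    by (simp add: algebra_simps)
  then have small: "r * (2 * m) + (\<Sum>i\<in>UNIV. up i) + (\<Sum>i\<in>UNIV. down i) \<le> r * (x + y + z)"
    unfolding D_def by (simp only: of_nat_le_iff add.assoc)

  define C' where "C' = H ^ (q * r) * (\<Prod>i\<in>UNIV. l i ^ b i)"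
  have "(\<Prod>i\<in>UNIV. l i ^ b i) * (\<Prod>i\<in>UNIV. l i ^ down i)
      = (\<Prod>i\<in>UNIV. l i ^ (a i * r)) * (\<Prod>i\<in>UNIV. l i ^ up i)"
    by (simp add: bal flip: prod.distrib power_add)
  then have C': "C' * (\<Prod>i\<in>UNIV. l i ^ down i) = C ^ r * (\<Prod>i\<in>UNIV. l i ^ up i)"
    by (simp add: C'_def C_def power_mult power_mult_distrib prod_power_distrib mult.assoc)
  have AB: "A ^ r = F ^ (q * r)" "B ^ r = G ^ (q * r)" by (simp_all add: A_def B_def power_mult)
  have "level_gap l F G H (q * r) b = syzygy_gap (A ^ r) (B ^ r) C'"
    by (simp add: level_gap_def AB C'_def)
  also have "\<dots> = int r * (int (x + y + z) - 2 * int m)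
      - int (\<Sum>i\<in>UNIV. up i) - int (\<Sum>i\<in>UNIV. down i)"
  proof (rule syzygy_gap_power_shift[OF r_def char nz deg s(1,2) forms coprime_forms _ _ _ C' _ small])
    show "up i = 0 \<or> down i = 0" for i by (rule disjoint)
    (* If t lies beyond u in a coordinate, then u is not at the end of the unit interval there,
       so the neighbour used in up_cond exists. *)
    show "\<not> l i dvd \<gamma>" if "up i > 0" for i
    proof (rule up_cond)
      have "a i * r < b i" using that by (simp add: up_def)
      also have "b i \<le> q * r" using kb(2)[of i] by (simp only: qr)
      finally have "a i * r < q * r" .
      then show "a i < q" by simp
    qed
    show "\<not> (l i dvd \<alpha> \<and> l i dvd \<beta>)" if "down i > 0" for i
    proof (rule down_cond)
      show "a i > 0" using that by (cases "a i") (auto simp: down_def)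
    qed
    show "common_factor_free (A ^ r) (B ^ r) C'"
      unfolding AB C'_def by (rule cell_common_factor_free[OF cell])
  qed
  also have "\<dots> = int r * (int (x + y + z) - 2 * int m) - int D"
    by (simp add: D_def)
  finally have "real_of_int (level_gap l F G H (q * r) b)
      = real r * (real (x + y + z) - 2 * real m) - real D"
    by simp
  moreover have "cell_gap l F G H t = real_of_int (level_gap l F G H (q * r) b) / real (q * r)"
    using cell_gap_eq[OF cell forms char refl kb(2,3)] by (simp only: qr)
  ultimately show ?thesis
    using pos unfolding dist val_u by (simp add: field_simps)
qed

theorem theorem2:
  fixes l :: "'n::finite \<Rightarrow> 'a::field bpoly"
    and F G H :: "'a bpoly"
    and p q :: nat
    and u :: "real ^ 'n"
  assumes char: "CHAR('a) = p" "p > 0"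
    and forms: "\<And>i. linear_form (l i)"
    and coprime_forms: "\<And>i j. i \<noteq> j \<Longrightarrow> coprime (l i) (l j)"
    and cell: "cell l F G H"
    and q: "\<exists>e. q = p ^ e"
    and u: "u \<in> grid q"
    and local_max: "\<And>t. t \<in> grid q \<Longrightarrow> adjacent q t u \<Longrightarrow> cell_gap l F G H t < cell_gap l F G H u"
  shows "(\<forall>t \<in> p_cube p. taxicab t u \<le> cell_gap l F G H u \<longrightarrow>
            cell_gap l F G H t = cell_gap l F G H u - taxicab t u)
       \<and> piecewise_linear_on {t \<in> p_cube p. taxicab t u \<le> cell_gap l F G H u} (cell_gap l F G H)
       \<and> (\<forall>\<^sub>F t in at u within p_cube p. cell_gap l F G H t \<le> cell_gap l F G H u)"
proof -
  have pos: "CHAR('a) > 0" using char by simp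
  obtain e where e: "q = CHAR('a) ^ e" using q char by auto
  have main: "cell_gap l F G H t = cell_gap l F G H u - taxicab t u"
    if "t \<in> p_cube p" "taxicab t u \<le> cell_gap l F G H u" for t
    using cell_gap_eq_minus_taxicab[OF cell forms coprime_forms pos e u local_max] that
    unfolding char(1) by blast
  have "piecewise_linear_on {t \<in> p_cube p. taxicab t u \<le> cell_gap l F G H u} (cell_gap l F G H)"
    by (rule piecewise_linear_on_minus_taxicab) (use main in blast)
  moreover have "\<forall>\<^sub>F t in at u within p_cube p. cell_gap l F G H t \<le> cell_gap l F G H u"
  proof -
    have "((\<lambda>t. taxicab t u) \<longlongrightarrow> taxicab u u) (nhds u)"
      unfolding taxicab_def by (intro tendsto_intros filterlim_ident)
    moreover have "taxicab u u < cell_gap l F G H u"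
      using cell_gap_pos_at_local_max[OF cell forms pos e u local_max] by (simp add: taxicab_def)
    ultimately have "\<forall>\<^sub>F t in nhds u. taxicab t u < cell_gap l F G H u"
      by (rule order_tendstoD(2))
    then show ?thesis
      unfolding eventually_at_filter
    proof (rule eventually_mono, intro impI)
      fix t assume "taxicab t u < cell_gap l F G H u" "t \<in> p_cube p"
      moreover have "0 \<le> taxicab t u" by (simp add: taxicab_def sum_nonneg)
      ultimately show "cell_gap l F G H t \<le> cell_gap l F G H u"
        using main[of t] by simp
    qed
  qed
  ultimately show ?thesis using main by blast
qed

end
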